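(* Consider finite sum problems $\min_{\mathbf{w}\in\mathbb{R}^d}F(\mathbf{w})$, $F=\frac1n\sum_{i=1}^n f_i$, with $L$-smooth and convex individual functions $f_i$. If the iteration complexity of an oblivious CLI optimization algorithm for such problems, equipped with the generalized first-order oracle and the steepest coordinate-descent oracle, is of the form $$\mathcal{O}\left(N+n^{\gamma}\left(L/\epsilon\right)^{\alpha}\right)$$ for some $N\in\mathbb{N}$ and $\alpha,\gamma>0$, then it must be at least $$\Omega\left(n+\sqrt{\frac{nL}{\epsilon}}\right).$$
   Context: Class of optimization problems: an ordered triple $(\mathcal{F},\mathcal{I},O_f)$, where $\mathcal{F}$ is a family of functions over a domain $\mathrm{dom}(\mathcal{F})$, $\mathcal{I}$ is the side-information given prior to the optimization process (e.g., the smoothness parameter $L$ and the number $n$ of individual functions), and $O_f$ is an oracle which, upon receiving $\mathbf{w}\in\mathrm{dom}(\mathcal{F})$ and a parameter $\theta$ in a parameter set $\Theta$, returns a set $O_f(\mathbf{w};\theta)\subseteq\mathrm{dom}(\mathcal{F})$, for a given $f\in\mathcal{F}$ (the subscript is omitted when clear). CLI algorithm: an optimization algorithm is a Canonical Linear Iterative (CLI) algorithm over $(\mathcal{F},\mathcal{I},O_f)$ if, given $f\in\mathcal{F}$ and initialization points $\{\mathbf{w}^{(0)}_i\}_{i\in\mathcal{J}}\subseteq\mathrm{dom}(\mathcal{F})$, $\mathcal{J}$ some index set, it iteratively generates points such that for every $i\in\mathcal{J}$, $$\mathbf{w}^{(k+1)}_i\in\sum_{j\in\mathcal{J}}O_f\left(\mathbf{w}^{(k)}_j;\theta^{(k)}_{ij}\right),\qquad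 k=0,1,\dots,$$ where $\theta^{(k)}_{ij}\in\Theta$ are parameters chosen, stochastically or deterministically, by the algorithm, possibly based on the side-information. The algorithm is oblivious if the parameters do not depend on previously acquired oracle answers. The solution returned after $k$ iterations is $\mathbf{w}^{(k)}_1$. Oracles, for $F=\frac1n\sum_{i=1}^n f_i$ on $\mathbb{R}^d$: - Generalized first-order oracle: $O(\mathbf{w};A,B,\mathbf{c},i)=A\nabla f_i(\mathbf{w})+B\mathbf{w}+\mathbf{c}$, - Steepest coordinate-descent oracle: $O(\mathbf{w};j,i)=\mathbf{w}+t^*\mathbf{e}_j$, where $A,B\in\mathbb{R}^{d\times d}$, $\mathbf{c}\in\mathbb{R}^d$, $i\in\{1,\dots,n\}$, $j\in\{1,\dots,d\}$, $\mathbf{e}_j$ is the $j$-th unit vector and $t^*\in\mathrm{argmin}_{t\in\mathbb{R}}f_i(w_1,\dots,w_{j-1},w_j+t,w_{j+1},\dots,w_d)$. Both oracles may be used during the same optimization process. The oracle parameters are restricted so that only one individual function is accessed at each iteration. Iteration complexity: the number of iterations (evaluations of individual functions through the oracles) needed, in the worst case over the class, to obtain an $\epsilon$-solution, i.e., a point $\mathbf{w}$ with $\mathbb{E}[F(\mathbf{w})-\min_{\mathbf{w}'}F(\mathbf{w}')]<\epsilon$, the expectation being over the randomness of the algorithm and the oracle. The dependence on the initial distance $\|\mathbf{w}^{(0)}-\mathbf{w}^*\|$ to a minimizer is suppressed. Here $N$ (which may depend on $n$) is the number of iterations from which the algorithm's convergence rate guarantee holds.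
   Formalization: The case n = 1, d = 1 (a single function of one real variable) is excluded: there one steepest coordinate-descent step returns an exact minimizer, so the iteration complexity is at most 1 and the claimed bound fails. *)

theory Defs
  imports "HOL-Probability.Probability"
begin

section \<open>Finite sums of smooth convex functions\<close>

definition gradient :: "('a::real_inner \<Rightarrow> real) \<Rightarrow> 'a \<Rightarrow> 'a" where
  "gradient f x = (THE D. GDERIV f x :> D)"

definition smooth_fun :: "real \<Rightarrow> ('a::real_inner \<Rightarrow> real) \<Rightarrow> bool" where
  "smooth_fun L f \<longleftrightarrow> (\<forall>x. GDERIV f x :> gradient f x) \<and> L-lipschitz_on UNIV (gradient f)"

definition finite_sum :: "nat \<Rightarrow> (nat \<Rightarrow> 'a \<Rightarrow> real) \<Rightarrow> 'a \<Rightarrow> real" where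
  "finite_sum n f w = (1 / real n) * (\<Sum>i = 1..n. f i w)"

text \<open>
  The problems whose average has a minimizer at distance at most \<open>R\<close> from \<open>x\<^sub>0\<close>. Without a bound
  on this distance every worst-case complexity would be infinite.
\<close>

definition problems :: "nat \<Rightarrow> real \<Rightarrow> real \<Rightarrow> 'a::real_inner \<Rightarrow> (nat \<Rightarrow> 'a \<Rightarrow> real) set" where
  "problems n L R x\<^sub>0 = {f.
     (\<forall>i\<in>{1..n}. convex_on UNIV (f i) \<and> smooth_fun L (f i)) \<and>
     (\<exists>z. (\<forall>w. finite_sum n f z \<le> finite_sum n f w) \<and> dist x\<^sub>0 z \<le> R)}"


section \<open>Oracles\<close>

datatype 'd oracle_param =
    First_Order "real^'d^'d" "real^'d^'d" "real^'d" nat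
  | Coordinate_Descent 'd nat

fun accessed :: "'d::finite oracle_param \<Rightarrow> nat" where
  "accessed (First_Order A B c i) = i"
| "accessed (Coordinate_Descent j i) = i"

text \<open>
  The coordinate-descent answer is empty if \<open>f i\<close> has no minimizer along the line, and it has more
  than one element if there are several.
\<close>

fun oracle_answers :: "(nat \<Rightarrow> real^'d \<Rightarrow> real) \<Rightarrow> real^'d \<Rightarrow> 'd::finite oracle_param \<Rightarrow> (real^'d) set" where
  "oracle_answers f w (First_Order A B c i) = {A *v gradient (f i) w + B *v w + c}"
| "oracle_answers f w (Coordinate_Descent j i) =
     {w + t *\<^sub>R axis j 1 | t. is_arg_min (\<lambda>s. f i (w + s *\<^sub>R axis j 1)) (\<lambda>_. True) t}"

text \<open>
  The disjoint-union sigma-algebra: Borel in the matrices and vectors, discrete in the indices.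
\<close>

definition param_space :: "'d::finite oracle_param measure" where
  "param_space = sigma UNIV
     ((\<lambda>X. (\<lambda>(A, B, c, i). First_Order A B c i) ` X) `
        sets (borel \<Otimes>\<^sub>M borel \<Otimes>\<^sub>M borel \<Otimes>\<^sub>M count_space UNIV) \<union>
      range (\<lambda>(j, i). {Coordinate_Descent j i}))"


section \<open>Oblivious canonical linear iterative algorithms\<close>

text \<open>
  \<open>params k i j\<close> is the random parameter used in iteration \<open>k\<close> to pass from the \<open>j\<close>-th point to the
  \<open>i\<close>-th one. The probability space carries the randomness of the algorithm and of the oracles.
  The objective does not occur in this record: this is obliviousness.
\<close>

record ('w, 'd) cli =
  points :: "nat set"
  init :: "nat \<Rightarrow> real^'d"
  space_of :: "'w measure"
  params :: "nat \<Rightarrow> nat \<Rightarrow> nat \<Rightarrow> 'w \<Rightarrow> 'd oracle_param"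

definition oblivious_cli :: "nat \<Rightarrow> ('w, 'd::finite) cli \<Rightarrow> bool" where
  "oblivious_cli n a \<longleftrightarrow>
     finite (points a) \<and> 1 \<in> points a \<and> prob_space (space_of a) \<and>
     (\<forall>k. \<forall>i\<in>points a. \<forall>j\<in>points a. params a k i j \<in> space_of a \<rightarrow>\<^sub>M param_space) \<and>
     (\<forall>\<omega>\<in>space (space_of a). \<forall>k. \<exists>m\<in>{1..n}.
        \<forall>i\<in>points a. \<forall>j\<in>points a. accessed (params a k i j \<omega>) = m)"

text \<open>
  The sum in the update is the Minkowski sum of sets. The points are determined by the parameters
  only up to the choice of an element of each set of answers, hence a relation.
\<close>

definition cli_run ::
  "(nat \<Rightarrow> real^'d \<Rightarrow> real) \<Rightarrow> ('w, 'd::finite) cli \<Rightarrow> (nat \<Rightarrow> nat \<Rightarrow> 'w \<Rightarrow> real^'d) \<Rightarrow> bool" where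
  "cli_run f a W \<longleftrightarrow>
     (\<forall>k. \<forall>i\<in>points a. W k i \<in> borel_measurable (space_of a)) \<and>
     (AE \<omega> in space_of a. \<forall>i\<in>points a. W 0 i \<omega> = init a i) \<and>
     (AE \<omega> in space_of a. \<forall>k. \<forall>i\<in>points a.
        W (Suc k) i \<omega> \<in> (\<Sum>j\<in>points a. oracle_answers f (W k j \<omega>) (params a k i j \<omega>)))"


section \<open>Iteration complexity\<close>

text \<open>
  The integrand is nonnegative whenever the minimum exists, and the integral in the extended
  nonnegative reals makes an infinite expectation count as a failure.
\<close>

definition eps_solution ::
  "real \<Rightarrow> 'w measure \<Rightarrow> ('a \<Rightarrow> real) \<Rightarrow> ('w \<Rightarrow> 'a) \<Rightarrow> bool" where
  "eps_solution \<epsilon> M F X \<longleftrightarrow> (\<integral>\<^sup>+ \<omega>. ennreal (F (X \<omega>) - (INF w. F w)) \<partial>M) < ennreal \<epsilon>"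

text \<open>
  The least \<open>k\<close> such that the point returned after \<open>k\<close> iterations is an \<open>\<epsilon>\<close>-solution for every
  problem of the class; infinity if there is none. One \<open>k\<close> has to serve the whole class: this is
  the number of iterations that a convergence guarantee for the class can promise.
\<close>

definition iteration_complexity ::
  "nat \<Rightarrow> real \<Rightarrow> real \<Rightarrow> real \<Rightarrow> ('w, 'd::finite) cli \<Rightarrow> enat" where
  "iteration_complexity n L R \<epsilon> a =
     (INF k \<in> {k. \<forall>f \<in> problems n L R (init a 1). \<forall>W. cli_run f a W \<longrightarrow>
                    eps_solution \<epsilon> (space_of a) (finite_sum n f) (W k 1)}. enat k)"

text \<open>
  Landau bounds for functions of \<open>n \<ge> n\<^sub>0\<close>, \<open>L\<close> and \<open>\<epsilon>\<close>, valid once \<open>L / \<epsilon>\<close> is large, uniformly in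
  \<open>n\<close> and \<open>L\<close>. The functions of \<open>HOL-Library.Landau_Symbols\<close> cannot take the value infinity.
\<close>

definition is_big_O ::
  "nat \<Rightarrow> (nat \<Rightarrow> real \<Rightarrow> real \<Rightarrow> enat) \<Rightarrow> (nat \<Rightarrow> real \<Rightarrow> real \<Rightarrow> real) \<Rightarrow> bool" where
  "is_big_O n\<^sub>0 T g \<longleftrightarrow> (\<exists>C>0. \<exists>\<kappa>>0. \<forall>n\<ge>n\<^sub>0. \<forall>L>0. \<forall>\<epsilon>>0. L / \<epsilon> \<ge> \<kappa> \<longrightarrow>
     ereal_of_enat (T n L \<epsilon>) \<le> ereal (C * g n L \<epsilon>))"

definition is_big_Omega ::
  "nat \<Rightarrow> (nat \<Rightarrow> real \<Rightarrow> real \<Rightarrow> enat) \<Rightarrow> (nat \<Rightarrow> real \<Rightarrow> real \<Rightarrow> real) \<Rightarrow> bool" where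
  "is_big_Omega n\<^sub>0 T g \<longleftrightarrow> (\<exists>c>0. \<exists>\<kappa>>0. \<forall>n\<ge>n\<^sub>0. \<forall>L>0. \<forall>\<epsilon>>0. L / \<epsilon> \<ge> \<kappa> \<longrightarrow>
     ereal (c * g n L \<epsilon>) \<le> ereal_of_enat (T n L \<epsilon>))"

end

theory Submission
  imports Defs
begin

text \<open>
  An oblivious algorithm cannot react to the objective, so its iterates on a family of quadratic
  problems with parameter \<open>\<eta>\<close> are explicit functions of \<open>\<eta>\<close>. The families below are chosen so that
  gradients and exact line minimizers are affine in \<open>\<eta>\<close> and depend on \<open>\<eta>\<close> only in one or two of the
  \<open>n\<close> components. Every iterate is then a polynomial in \<open>\<eta>\<close> whose degree is at most the number of
  accesses to these components (lemma \<open>poly_trajectory\<close>). Each family comes in two versions, for the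
  signs \<open>s = 1\<close> and \<open>s = -1\<close>, whose minimizers lie far apart although the two versions coincide at
  \<open>\<eta> = 0\<close>. The difference \<open>q(\<eta>)\<close> of the two runs is thus a polynomial of low degree with \<open>q(0) = 0\<close>.
  If both runs were accurate, it would be close to the distance of the minimizers for all \<open>\<eta> > 0\<close>.

  The question is how large a polynomial of degree \<open>T\<close> can be at \<open>0\<close> if it is small for \<open>\<eta> > 0\<close>. For flat
  problems \<open>\<eta> / (2 * n) * (y - z)\<^sup>2\<close> with \<open>0 < \<eta> \<le> L\<close>, an error below \<open>\<epsilon>\<close> only bounds \<open>y - z\<close> by
  \<open>sqrt (2 * n * \<epsilon> / \<eta>)\<close>. Interpolation at the nodes \<open>\<eta>\<close> proportional to \<open>1\<^sup>2, 3\<^sup>2, 5\<^sup>2, \<dots>\<close> shows that the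
  value at \<open>0\<close> is then at most of order \<open>T * sqrt (n * \<epsilon> / L)\<close> (lemma \<open>interpolation_at_zero\<close>), a
  dual form of the Bernstein inequality for the odd polynomial \<open>x * q(x\<^sup>2)\<close>. Nodes and weights depend on
  \<open>T\<close> and \<open>L\<close> alone. This makes the argument work for randomized algorithms: the identity holds for every
  outcome with at most \<open>T\<close> accesses and can be integrated, whereas the error is only controlled in
  expectation, for each node separately.

  Since one iteration accesses one component, among the \<open>n\<close> possible places for the hard components
  one is hit at most \<open>T\<close> times with probability at least \<open>1/2\<close>, where \<open>T\<close> is about \<open>4 * k / n\<close>. Hence
  \<open>R * sqrt L \<le> C * (k / n + 1) * sqrt (n * \<epsilon>)\<close>, which is the bound \<open>sqrt (n * L / \<epsilon>)\<close> up to a term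
  of order \<open>n\<close> (lemma \<open>iterations_ge_sqrt\<close>). The bound \<open>n\<close> itself is the case \<open>T = 0\<close> of the same
  comparison (lemma \<open>iterations_ge_components\<close>): a single component \<open>L / 2 * (y - s * n * R)\<^sup>2\<close> whose
  minimizer is very far away moves the minimizer of the average by \<open>s * R\<close>, and an algorithm that has
  not accessed it cannot know the sign.

  Exact line minimization is harmless if its answers are polynomials in \<open>\<eta>\<close> as well. For \<open>n \<ge> 2\<close> this
  is achieved by splitting the flat function into two components with fixed minimizers \<open>R\<close> and \<open>- R\<close>,
  whose curvatures carry the sign. For a single component, the dimension must be at least two, and a
  quadratic form with eigenvalues \<open>\<eta>\<close> and \<open>L - \<eta>\<close> along the diagonals of a coordinate plane serves the
  purpose, since its diagonal entries are constant.
\<close>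


section \<open>Evaluating a polynomial at zero from its values on an interval\<close>

lemma lagrange_interpolation:
  fixes x :: "nat \<Rightarrow> real" and q :: "real poly"
  assumes inj: "inj_on x {..<m}" and deg: "degree q < m"
  shows "poly q y = (\<Sum>j<m. (\<Prod>l\<in>{..<m} - {j}. (y - x l) / (x j - x l)) * poly q (x j))"
proof -
  define b where "b j = (\<Prod>l\<in>{..<m} - {j}. smult (1 / (x j - x l)) [:- x l, 1:])" for j
  define Q where "Q = (\<Sum>j<m. smult (poly q (x j)) (b j))"
  have poly_b: "poly (b j) y = (\<Prod>l\<in>{..<m} - {j}. (y - x l) / (x j - x l))" for j y
    by (simp add: b_def poly_prod diff_divide_distrib)
  have at_node: "poly (b j) (x i) = of_bool (i = j)" if "i < m" "j < m" for i j
  proof (cases "i = j")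
    case True
    then show ?thesis
      using that inj_onD[OF inj, of i] by (auto simp: poly_b intro!: prod.neutral split: if_splits)
  next
    case False
    then show ?thesis
      using that by (auto simp: poly_b intro!: bexI[of _ i])
  qed
  have "degree (b j) \<le> m - 1" if "j < m" for j
  proof -
    have "degree (b j) \<le> (\<Sum>l\<in>{..<m} - {j}. (degree \<circ> (\<lambda>l. smult (1 / (x j - x l)) [:- x l, 1:])) l)"
      unfolding b_def by (rule degree_prod_sum_le) simp
    also have "\<dots> \<le> (\<Sum>l\<in>{..<m} - {j}. 1)"
      by (intro sum_mono) simp
    finally show ?thesis
      using that by simp
  qed
  then have "degree Q \<le> m - 1"
    unfolding Q_def by (intro degree_sum_le) (auto intro: order_trans[OF degree_smult_le])
  moreover have "poly q z = poly Q z" if "z \<in> x ` {..<m}" for z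
    using that by (auto simp: Q_def poly_sum at_node of_bool_def if_distrib if_distribR cong: if_cong)
  moreover have "card (x ` {..<m}) = m"
    using inj by (simp add: card_image)
  ultimately have "q = Q"
    using deg by (intro poly_eqI_degree[of "x ` {..<m}"]) auto
  then have "poly q y = poly Q y"
    by simp
  also have "\<dots> = (\<Sum>j<m. poly (b j) y * poly q (x j))"
    by (simp add: Q_def poly_sum mult.commute)
  finally show ?thesis
    by (simp add: poly_b)
qed

definition odd_square :: "nat \<Rightarrow> real" where
  "odd_square l = (2 * real l + 1)\<^sup>2"

text \<open>
  The Lagrange weights at \<open>0\<close> for the nodes \<open>odd_square 0, \<dots>, odd_square (m - 1)\<close>. They do not change
  when all nodes are multiplied by the same number.
\<close>

definition odd_square_weight :: "nat \<Rightarrow> nat \<Rightarrow> real" where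
  "odd_square_weight m j = (\<Prod>l\<in>{..<m} - {j}. odd_square l / (odd_square l - odd_square j))"

lemma odd_square_pos: "odd_square l > 0"
  by (simp add: odd_square_def add_pos_nonneg)

lemma odd_square_diff: "odd_square l - odd_square j = 4 * (real l - real j) * (real l + real j + 1)"
  by (simp add: odd_square_def power2_eq_square algebra_simps)

lemma odd_square_inj: "odd_square l = odd_square j \<longleftrightarrow> l = j"
  using odd_square_diff[of l j] by (auto simp: add_eq_0_iff)

text \<open>
  The inequality \<open>((2m)! / (2\<^sup>m * m!))\<^sup>2 * (2 * m + 1) \<le> 4\<^sup>m * (m!)\<^sup>2\<close>, that is, the central binomial
  coefficient is at most \<open>4\<^sup>m / sqrt (2 * m + 1)\<close>.
\<close>

lemma prod_odd_square_le: "(\<Prod>l<m. odd_square l) * (2 * real m + 1) \<le> 4 ^ m * (fact m)\<^sup>2"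
proof (induction m)
  case 0
  then show ?case by simp
next
  case (Suc m)
  have "(\<Prod>l<Suc m. odd_square l) * (2 * real (Suc m) + 1)
      = ((\<Prod>l<m. odd_square l) * (2 * real m + 1)) * ((2 * real m + 1) * (2 * real m + 3))"
    by (simp add: odd_square_def power2_eq_square algebra_simps)
  also have "\<dots> \<le> (4 ^ m * (fact m)\<^sup>2) * (4 * (real m + 1)\<^sup>2)"
    by (rule mult_mono[OF Suc]) (auto simp: power2_eq_square algebra_simps)
  also have "\<dots> = 4 ^ Suc m * (fact (Suc m))\<^sup>2"
    by (simp add: power2_eq_square algebra_simps)
  finally show ?case .
qed

text \<open>
  Each factor is \<open>4 * \<bar>l - j\<bar> * (l + j + 1)\<close>. The factors with \<open>l < j\<close> give a quotient of factorials by
  induction, and every further factor extends both factorials on the right-hand side by one.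
\<close>

lemma prod_odd_square_diff:
  assumes "j < m"
  shows "(\<Prod>l\<in>{..<m} - {j}. \<bar>odd_square l - odd_square j\<bar>) * (2 * real j + 1)
    = 4 ^ (m - 1) * (fact (m - 1 - j) * fact (m + j))"
proof -
  \<comment> \<open>The factor \<open>fact (j - i)\<close> avoids a division. It disappears at \<open>i = j\<close>.\<close>
  have below: "(\<Prod>l<i. \<bar>odd_square l - odd_square j\<bar>) * fact (j - i) = 4 ^ i * fact (j + i)"
    if "i \<le> j" for i
    using that
  proof (induction i)
    case 0
    then show ?case by simp
  next
    case (Suc i)
    have *: "\<bar>odd_square i - odd_square j\<bar> = 4 * (real j - real i) * (real i + real j + 1)"
      using Suc.prems by (simp add: odd_square_diff abs_mult)
    have "fact (j - i) = (real j - real i) * fact (j - Suc i)"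
      using Suc.prems by (metis Suc_diff_Suc Suc_le_lessD fact_Suc less_imp_le_nat of_nat_diff)
    then have "(\<Prod>l<Suc i. \<bar>odd_square l - odd_square j\<bar>) * fact (j - Suc i)
      = 4 * (real i + real j + 1) * ((\<Prod>l<i. \<bar>odd_square l - odd_square j\<bar>) * fact (j - i))"
      by (simp only: prod.lessThan_Suc *) (simp only: mult_ac)
    also have "\<dots> = 4 * (real i + real j + 1) * (4 ^ i * fact (j + i))"
      using Suc by simp
    also have "\<dots> = 4 ^ Suc i * fact (j + Suc i)"
      by (simp add: algebra_simps)
    finally show ?case .
  qed
  have "(\<Prod>l\<in>{..<Suc j + i} - {j}. \<bar>odd_square l - odd_square j\<bar>) * (2 * real j + 1)
      = 4 ^ (j + i) * (fact i * fact (Suc j + i + j))" for i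
  proof (induction i)
    case 0
    have "{..<Suc j} - {j} = {..<j}" by auto
    then show ?case
      using below[of j] by (simp add: algebra_simps)
  next
    case (Suc i)
    have "{..<Suc j + Suc i} - {j} = insert (Suc j + i) ({..<Suc j + i} - {j})" by auto
    then have "(\<Prod>l\<in>{..<Suc j + Suc i} - {j}. \<bar>odd_square l - odd_square j\<bar>) * (2 * real j + 1)
      = \<bar>odd_square (Suc j + i) - odd_square j\<bar> * (4 ^ (j + i) * (fact i * fact (Suc j + i + j)))"
      using Suc by simp
    also have "\<bar>odd_square (Suc j + i) - odd_square j\<bar> = 4 * real (Suc i) * real (Suc j + Suc i + j)"
      by (simp add: odd_square_diff abs_mult)
    also have "\<dots> * (4 ^ (j + i) * (fact i * fact (Suc j + i + j)))
      = 4 ^ (j + Suc i) * ((real (Suc i) * fact i) * (real (Suc j + Suc i + j) * fact (Suc j + i + j)))"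
      by simp
    also have "\<dots> = 4 ^ (j + Suc i) * (fact (Suc i) * fact (Suc j + Suc i + j))"
      by simp
    finally show ?case .
  qed
  from this[of "m - Suc j"] show ?thesis
    using assms by simp
qed

text \<open>
  Among the products of two factorials with a fixed sum of arguments the balanced one is the smallest.
\<close>

lemma fact_mult_fact_spread:
  assumes "j < m"
  shows "fact (m - 1) * fact m \<le> (fact (m - 1 - j) * fact (m + j) :: real)"
  using assms
proof (induction j)
  case 0
  then show ?case by simp
next
  case (Suc j)
  have "fact (m - 1 - j) = real (m - 1 - j) * fact (m - 1 - Suc j)"
    using Suc.prems by (metis Suc_diff_Suc fact_Suc less_diff_conv Suc_eq_plus1)
  then have "fact (m - 1 - j) * fact (m + j) = real (m - 1 - j) * (fact (m - 1 - Suc j) * fact (m + j))"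
    by simp
  also have "\<dots> \<le> real (m + Suc j) * (fact (m - 1 - Suc j) * fact (m + j))"
    by (intro mult_right_mono) auto
  also have "\<dots> = fact (m - 1 - Suc j) * fact (m + Suc j)"
    by simp
  finally have "fact (m - 1 - j) * fact (m + j) \<le> (fact (m - 1 - Suc j) * fact (m + Suc j) :: real)" .
  moreover have "fact (m - 1) * fact m \<le> (fact (m - 1 - j) * fact (m + j) :: real)"
    using Suc by simp
  ultimately show ?case
    by (rule order_trans[rotated])
qed

text \<open>
  The decay in \<open>j\<close> is the point of the odd squares. For the nodes \<open>j\<^sup>2\<close> the weights stay away from \<open>0\<close>
  up to \<open>j\<close> of order \<open>sqrt m\<close>, and the sum in \<open>interpolation_at_zero\<close> would grow by a factor of order
  \<open>ln m\<close>.
\<close>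

lemma abs_odd_square_weight_le:
  assumes "j < m"
  shows "\<bar>odd_square_weight m j\<bar> \<le> 2 / (2 * real j + 1)"
proof -
  define D where "D = (\<Prod>l\<in>{..<m} - {j}. \<bar>odd_square l - odd_square j\<bar>)"
  define P where "P = (\<Prod>l<m. odd_square l)"
  define r where "r = 2 * real j + 1"
  have pos: "r > 0" "D > 0"
    by (auto simp: r_def D_def odd_square_inj intro!: prod_pos)
  have "P = odd_square j * (\<Prod>l\<in>{..<m} - {j}. odd_square l)"
    using assms by (simp add: P_def prod.remove[of _ j])
  then have "\<bar>odd_square_weight m j\<bar> = P / r\<^sup>2 / D"
    using pos
    by (simp add: odd_square_weight_def abs_prod prod_dividef D_def odd_square_def r_def)
  also have "\<dots> = P / (r * (D * r))"
    by (simp add: power2_eq_square mult_ac)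
  also have "\<dots> \<le> 2 / r"
  proof -
    obtain m' where m: "m = Suc m'" using assms by (cases m) auto
    have "P * (2 * real m + 1) \<le> 4 ^ m * (fact m)\<^sup>2"
      unfolding P_def by (rule prod_odd_square_le)
    also have "\<dots> = 4 * real m * (4 ^ (m - 1) * (fact (m - 1) * fact m))"
      by (simp add: m power2_eq_square)
    also have "\<dots> \<le> 4 * real m * (D * r)"
      unfolding D_def r_def prod_odd_square_diff[OF assms]
      by (intro mult_left_mono fact_mult_fact_spread assms) auto
    also have "\<dots> \<le> 2 * (D * r) * (2 * real m + 1)"
      using pos by (simp add: algebra_simps)
    finally have "P \<le> 2 * (D * r)"
      by simp
    then show ?thesis
      using pos by (simp add: field_simps)
  qed
  finally show ?thesis
    by (simp add: r_def)
qed

lemma sum_inverse_odd_square_le: "(\<Sum>j<m. 1 / odd_square j) \<le> 2"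
proof -
  have "(\<Sum>j<m. 1 / odd_square j) \<le> 2 - 2 / (2 * real m + 1)"
  proof (induction m)
    case 0
    then show ?case by simp
  next
    case (Suc m)
    have "1 / odd_square m \<le> 1 / ((2 * real m + 1) * (real m / 2 + 3 / 4))"
      unfolding odd_square_def power2_eq_square
      by (intro divide_left_mono mult_left_mono) auto
    also have "\<dots> = 2 / (2 * real m + 1) - 2 / (2 * real m + 3)"
      by (simp add: field_simps)
    finally have "1 / odd_square m \<le> 2 / (2 * real m + 1) - 2 / (2 * real m + 3)" .
    with Suc show ?case
      by (simp add: algebra_simps)
  qed
  also have "\<dots> \<le> 2" by simp
  finally show ?thesis .
qed

text \<open>
  The weight \<open>1 / sqrt \<eta>\<close> is the size of the error that a function of curvature \<open>\<eta>\<close> permits. The nodes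
  are the odd squares, scaled such that the largest is \<open>L\<close> and the smallest \<open>L / (2 * T + 1)\<^sup>2\<close>, and the
  terms decay like the inverse squares of the odd numbers.
\<close>

lemma interpolation_at_zero:
  fixes L :: real
  assumes L: "L > 0"
  obtains \<eta> c :: "nat \<Rightarrow> real" where
    "\<And>j. j \<le> T \<Longrightarrow> 0 < \<eta> j \<and> \<eta> j \<le> L"
    and "\<And>q :: real poly. degree q \<le> T \<Longrightarrow> poly q 0 = (\<Sum>j\<le>T. c j * poly q (\<eta> j))"
    and "(\<Sum>j\<le>T. \<bar>c j\<bar> / sqrt (\<eta> j)) \<le> 4 * (2 * real T + 1) / sqrt L"
proof
  define h where "h = L / odd_square T"
  have h: "h > 0" using L odd_square_pos by (simp add: h_def)
  let ?\<eta> = "\<lambda>j. h * odd_square j" and ?c = "odd_square_weight (Suc T)"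
  show "0 < ?\<eta> j \<and> ?\<eta> j \<le> L" if "j \<le> T" for j
  proof -
    have "odd_square j \<le> odd_square T"
      unfolding odd_square_def using that by (intro power_mono) auto
    then have "h * odd_square j \<le> h * odd_square T"
      using h by (intro mult_left_mono) auto
    also have "\<dots> = L"
      using odd_square_pos[of T] by (simp add: h_def)
    finally show ?thesis
      using h odd_square_pos[of j] by simp
  qed
  show "poly q 0 = (\<Sum>j\<le>T. ?c j * poly q (?\<eta> j))" if "degree q \<le> T" for q :: "real poly"
  proof -
    have "(0 - ?\<eta> l) / (?\<eta> j - ?\<eta> l) = odd_square l / (odd_square l - odd_square j)" for l j
    proof -
      have "(0 - ?\<eta> l) / (?\<eta> j - ?\<eta> l) = (- h * odd_square l) / (- h * (odd_square l - odd_square j))"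
        by (simp add: algebra_simps)
      also have "\<dots> = odd_square l / (odd_square l - odd_square j)"
        using h by (subst mult_divide_mult_cancel_left) auto
      finally show ?thesis .
    qed
    moreover have "inj_on ?\<eta> {..<Suc T}"
      using h by (auto simp: inj_on_def odd_square_inj)
    ultimately show ?thesis
      using lagrange_interpolation[of ?\<eta> "Suc T" q 0] that
      by (simp add: odd_square_weight_def lessThan_Suc_atMost)
  qed
  have sqrt_\<eta>: "sqrt (?\<eta> j) = sqrt h * (2 * real j + 1)" for j
    by (simp add: odd_square_def real_sqrt_mult)
  have "(\<Sum>j\<le>T. \<bar>?c j\<bar> / sqrt (?\<eta> j)) \<le> (\<Sum>j\<le>T. 2 / sqrt h * (1 / odd_square j))"
  proof (intro sum_mono)
    fix j assume "j \<in> {..T}"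
    then have "\<bar>?c j\<bar> / sqrt (?\<eta> j) \<le> 2 / (2 * real j + 1) / (sqrt h * (2 * real j + 1))"
      unfolding sqrt_\<eta> using h
      by (intro divide_right_mono abs_odd_square_weight_le) auto
    also have "\<dots> = 2 / sqrt h * (1 / odd_square j)"
      by (simp add: odd_square_def power2_eq_square)
    finally show "\<bar>?c j\<bar> / sqrt (?\<eta> j) \<le> 2 / sqrt h * (1 / odd_square j)" .
  qed
  also have "\<dots> = 2 / sqrt h * (\<Sum>j<Suc T. 1 / odd_square j)"
    by (simp only: sum_distrib_left lessThan_Suc_atMost)
  also have "\<dots> \<le> 2 / sqrt h * 2"
    using h by (intro mult_left_mono sum_inverse_odd_square_le) auto
  also have "\<dots> = 4 * (2 * real T + 1) / sqrt L"
    by (simp add: h_def real_sqrt_divide odd_square_def)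
  finally show "(\<Sum>j\<le>T. \<bar>?c j\<bar> / sqrt (?\<eta> j)) \<le> 4 * (2 * real T + 1) / sqrt L" .
qed

section \<open>Curves with polynomial coordinates\<close>

text \<open>
  Degrees are tested on inner products with fixed vectors, which makes the notion independent of
  coordinates and applies to real-valued curves as well. A linear map moves to its adjoint on the
  other side of the inner product.
\<close>

definition poly_curve :: "nat \<Rightarrow> (real \<Rightarrow> 'a::real_inner) \<Rightarrow> bool" where
  "poly_curve m w \<longleftrightarrow> (\<forall>x. \<exists>q. degree q \<le> m \<and> (\<forall>\<eta>. x \<bullet> w \<eta> = poly q \<eta>))"

lemma poly_curve_const: "poly_curve m (\<lambda>_. c)"
  unfolding poly_curve_def
proof
  fix x
  show "\<exists>q. degree q \<le> m \<and> (\<forall>\<eta>. x \<bullet> c = poly q \<eta>)"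
    by (rule exI[of _ "[:x \<bullet> c:]"]) auto
qed

lemma poly_curve_mono: "poly_curve m w \<Longrightarrow> m \<le> k \<Longrightarrow> poly_curve k w"
  unfolding poly_curve_def by (meson order_trans)

lemma poly_curve_add:
  assumes "poly_curve m w" "poly_curve m w'"
  shows "poly_curve m (\<lambda>\<eta>. w \<eta> + w' \<eta>)"
  unfolding poly_curve_def
proof
  fix x
  obtain q q' where "degree q \<le> m" "\<And>\<eta>. x \<bullet> w \<eta> = poly q \<eta>" "degree q' \<le> m" "\<And>\<eta>. x \<bullet> w' \<eta> = poly q' \<eta>"
    using assms unfolding poly_curve_def by metis
  then show "\<exists>q. degree q \<le> m \<and> (\<forall>\<eta>. x \<bullet> (w \<eta> + w' \<eta>) = poly q \<eta>)"
    by (intro exI[of _ "q + q'"]) (auto simp: inner_add_right degree_add_le)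
qed

lemma poly_curve_sum:
  assumes "\<And>j. j \<in> A \<Longrightarrow> poly_curve m (w j)"
  shows "poly_curve m (\<lambda>\<eta>. \<Sum>j\<in>A. w j \<eta>)"
  using assms by (induction A rule: infinite_finite_induct) (auto intro: poly_curve_const poly_curve_add)

lemma poly_curve_adjoint:
  assumes "poly_curve m w" "\<And>x y. x \<bullet> f y = f' x \<bullet> y"
  shows "poly_curve m (\<lambda>\<eta>. f (w \<eta>))"
  using assms unfolding poly_curve_def by simp

lemma poly_curve_matrix:
  fixes A :: "real^'n::finite^'m::finite"
  shows "poly_curve m w \<Longrightarrow> poly_curve m (\<lambda>\<eta>. A *v w \<eta>)"
  by (rule poly_curve_adjoint[where f' = "\<lambda>x. x v* A"]) (simp_all add: dot_lmul_matrix)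

lemma poly_curve_scaleR: "poly_curve m w \<Longrightarrow> poly_curve m (\<lambda>\<eta>. c *\<^sub>R w \<eta>)"
  by (rule poly_curve_adjoint[where f' = "\<lambda>x. c *\<^sub>R x"]) simp_all

lemma poly_curve_minus: "poly_curve m w \<Longrightarrow> poly_curve m (\<lambda>\<eta>. - w \<eta>)"
  using poly_curve_scaleR[of m w "-1"] by simp

lemma poly_curve_diff: "poly_curve m w \<Longrightarrow> poly_curve m w' \<Longrightarrow> poly_curve m (\<lambda>\<eta>. w \<eta> - w' \<eta>)"
  using poly_curve_add[OF _ poly_curve_minus, of m w w'] by simp

lemma poly_curve_inner: "poly_curve m w \<Longrightarrow> poly_curve m (\<lambda>\<eta>. v \<bullet> w \<eta>)"
  by (rule poly_curve_adjoint[where f' = "\<lambda>x. x *\<^sub>R v"]) simp_all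

lemma poly_curve_times_vector: "poly_curve m w \<Longrightarrow> poly_curve m (\<lambda>\<eta>. w \<eta> *\<^sub>R v)"
  by (rule poly_curve_adjoint[where f' = "\<lambda>x. x \<bullet> v"]) (simp_all add: mult.commute)

lemma poly_curve_id_times:
  assumes "poly_curve m w"
  shows "poly_curve (Suc m) (\<lambda>\<eta>. \<eta> *\<^sub>R w \<eta>)"
  unfolding poly_curve_def
proof
  fix x
  obtain q where "degree q \<le> m" "\<And>\<eta>. x \<bullet> w \<eta> = poly q \<eta>"
    using assms unfolding poly_curve_def by metis
  then show "\<exists>q. degree q \<le> Suc m \<and> (\<forall>\<eta>. x \<bullet> (\<eta> *\<^sub>R w \<eta>) = poly q \<eta>)"
    by (intro exI[of _ "pCons 0 q"]) auto
qed

section \<open>Runs driven by gradients and exact line minimizers\<close>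

text \<open>
  The \<open>\<sigma>\<close>-algebra contains all images of measurable sets under \<open>First_Order\<close>, and there are only
  countably many parameters of the other kind. So only the former restrict measurability.
\<close>

lemma measurable_param_space:
  fixes g :: "'d::finite oracle_param \<Rightarrow> 'c"
  assumes first_order: "(\<lambda>(A, B, c, i). g (First_Order A B c i))
      \<in> borel \<Otimes>\<^sub>M borel \<Otimes>\<^sub>M borel \<Otimes>\<^sub>M count_space UNIV \<rightarrow>\<^sub>M N"
    and coordinate: "\<And>j i. g (Coordinate_Descent j i) \<in> space N"
  shows "g \<in> param_space \<rightarrow>\<^sub>M N"
proof (rule measurableI)
  let ?P = "borel \<Otimes>\<^sub>M borel \<Otimes>\<^sub>M borel \<Otimes>\<^sub>M count_space UNIV ::
    ((real^'d^'d) \<times> (real^'d^'d) \<times> (real^'d) \<times> nat) measure"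
  let ?h = "\<lambda>(A, B, c, i). First_Order A B c i :: 'd oracle_param"
  have P: "space ?P = UNIV"
    by (simp add: space_pair_measure)
  have h: "g (?h x) \<in> space N" for x
    using measurable_space[OF first_order, of x] by (simp add: P split_beta)
  fix \<theta> show "g \<theta> \<in> space N"
  proof (cases \<theta>)
    case (First_Order A B c i)
    then show ?thesis using h[of "(A, B, c, i)"] by simp
  qed (simp add: coordinate)
next
  let ?P = "borel \<Otimes>\<^sub>M borel \<Otimes>\<^sub>M borel \<Otimes>\<^sub>M count_space UNIV ::
    ((real^'d^'d) \<times> (real^'d^'d) \<times> (real^'d) \<times> nat) measure"
  let ?h = "\<lambda>(A, B, c, i). First_Order A B c i :: 'd oracle_param"
  let ?G = "(\<lambda>X. ?h ` X) ` sets ?P \<union> range (\<lambda>(j, i). {Coordinate_Descent j i :: 'd oracle_param})"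
  fix Y assume Y: "Y \<in> sets N"
  define X where "X = (\<lambda>(A, B, c, i). g (First_Order A B c i)) -` Y \<inter> space ?P"
  have "X \<in> sets ?P"
    unfolding X_def using first_order Y by (rule measurable_sets)
  then have "?h ` X \<in> sigma_sets UNIV ?G"
    by (intro sigma_sets.Basic) auto
  moreover have "(\<Union>(j, i)\<in>{(j, i). g (Coordinate_Descent j i) \<in> Y}. {Coordinate_Descent j i}) \<in> sigma_sets UNIV ?G"
    by (intro sigma_sets_UNION) (auto intro!: sigma_sets.Basic)
  ultimately have "?h ` X \<union> (\<Union>(j, i)\<in>{(j, i). g (Coordinate_Descent j i) \<in> Y}. {Coordinate_Descent j i})
      \<in> sigma_sets UNIV ?G"
    by (rule sigma_sets_Un)
  moreover have "g -` Y \<inter> space param_space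
      = ?h ` X \<union> (\<Union>(j, i)\<in>{(j, i). g (Coordinate_Descent j i) \<in> Y}. {Coordinate_Descent j i})"
  proof -
    have "\<theta> \<in> ?h ` X \<union> (\<Union>(j, i)\<in>{(j, i). g (Coordinate_Descent j i) \<in> Y}. {Coordinate_Descent j i})
      \<longleftrightarrow> g \<theta> \<in> Y" for \<theta>
      by (cases \<theta>) (auto simp: X_def space_pair_measure image_iff Bex_def)
    then show ?thesis
      unfolding set_eq_iff by (simp add: param_space_def space_measure_of_conv)
  qed
  ultimately show "g -` Y \<inter> space param_space \<in> sets param_space"
    by (simp add: param_space_def sets_measure_of_conv)
qed

lemma measurable_accessed: "accessed \<in> param_space \<rightarrow>\<^sub>M count_space UNIV"
  by (rule measurable_param_space) (simp_all add: split_beta)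

text \<open>
  One selected oracle answer: \<open>g i\<close> stands for the gradient of the \<open>i\<close>-th function, and \<open>t i j w\<close> for
  the length of a minimizing step from \<open>w\<close> along the \<open>j\<close>-th coordinate. Keeping both as parameters
  allows a choice of the minimizer, also where it is not unique, that is polynomial in \<open>\<eta>\<close>.
\<close>

fun oracle_step ::
  "(nat \<Rightarrow> real^'d \<Rightarrow> real^'d) \<Rightarrow> (nat \<Rightarrow> 'd::finite \<Rightarrow> real^'d \<Rightarrow> real) \<Rightarrow> real^'d \<Rightarrow> 'd oracle_param \<Rightarrow> real^'d"
where
  "oracle_step g t w (First_Order A B c i) = A *v g i w + B *v w + c"
| "oracle_step g t w (Coordinate_Descent j i) = w + t i j w *\<^sub>R axis j 1"

lemma borel_measurable_matrix_vector_mult [measurable (raw)]: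
  fixes A :: "'w \<Rightarrow> real^'m::finite^'n::finite"
  assumes A: "A \<in> borel_measurable M" and w: "w \<in> borel_measurable M"
  shows "(\<lambda>\<omega>. A \<omega> *v w \<omega>) \<in> borel_measurable M"
proof -
  have "(\<lambda>x. fst x *v snd x :: real^'n) \<in> borel_measurable (borel :: ((real^'m^'n) \<times> (real^'m)) measure)"
    unfolding matrix_vector_mult_def
    by (intro borel_measurable_continuous_onI continuous_intros)
  from measurable_compose[OF borel_measurable_Pair[OF A w] this] show ?thesis
    by simp
qed

lemma measurable_oracle_step:
  fixes w :: "'w \<Rightarrow> real^'d::finite"
  assumes g: "\<And>i. continuous_on UNIV (g i)" and t: "\<And>i j. continuous_on UNIV (t i j)"
    and w: "w \<in> borel_measurable M" and \<theta>: "\<theta> \<in> M \<rightarrow>\<^sub>M param_space"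
  shows "(\<lambda>\<omega>. oracle_step g t (w \<omega>) (\<theta> \<omega>)) \<in> borel_measurable M"
proof -
  define A where "A = (\<lambda>\<theta>. case \<theta> of First_Order A B c i \<Rightarrow> A | Coordinate_Descent j i \<Rightarrow> (0 :: real^'d^'d))"
  define B where "B = (\<lambda>\<theta>. case \<theta> of First_Order A B c i \<Rightarrow> B | Coordinate_Descent j i \<Rightarrow> (0 :: real^'d^'d))"
  define c where "c = (\<lambda>\<theta>. case \<theta> of First_Order A B c i \<Rightarrow> c | Coordinate_Descent j i \<Rightarrow> (0 :: real^'d))"
  \<comment> \<open>The two kinds of parameters are merged by \<open>J\<close>, which is \<open>None\<close> for first-order queries.\<close>
  define J where "J = (\<lambda>\<theta>. case \<theta> of First_Order A B c i \<Rightarrow> None | Coordinate_Descent j i \<Rightarrow> Some (j :: 'd))"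
  have [measurable]: "(\<lambda>\<omega>. A (\<theta> \<omega>)) \<in> borel_measurable M" "(\<lambda>\<omega>. B (\<theta> \<omega>)) \<in> borel_measurable M"
    "(\<lambda>\<omega>. c (\<theta> \<omega>)) \<in> borel_measurable M" "(\<lambda>\<omega>. J (\<theta> \<omega>)) \<in> M \<rightarrow>\<^sub>M count_space UNIV"
    "(\<lambda>\<omega>. accessed (\<theta> \<omega>)) \<in> M \<rightarrow>\<^sub>M count_space UNIV"
    unfolding A_def B_def c_def J_def
    by (rule measurable_compose[OF \<theta> measurable_param_space]
          measurable_compose[OF \<theta> measurable_accessed];
        simp add: split_beta)+
  note w[measurable]
  have "(\<lambda>\<omega>. g i (w \<omega>)) \<in> borel_measurable M" "(\<lambda>\<omega>. t i j (w \<omega>)) \<in> borel_measurable M" for i j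
    using g t by (auto intro!: measurable_compose[OF w] borel_measurable_continuous_onI)
  note [measurable] = this
  have *: "oracle_step g t (w \<omega>) (\<theta> \<omega>) = (case J (\<theta> \<omega>) of
      None \<Rightarrow> A (\<theta> \<omega>) *v g (accessed (\<theta> \<omega>)) (w \<omega>) + B (\<theta> \<omega>) *v w \<omega> + c (\<theta> \<omega>)
    | Some j \<Rightarrow> w \<omega> + t (accessed (\<theta> \<omega>)) j (w \<omega>) *\<^sub>R axis j 1)" for \<omega>
    by (cases "\<theta> \<omega>") (auto simp: A_def B_def c_def J_def)
  have [measurable]: "(\<lambda>\<omega>. g (accessed (\<theta> \<omega>)) (w \<omega>)) \<in> borel_measurable M"
    by (rule measurable_compose_countable[where f = "\<lambda>i \<omega>. g i (w \<omega>)"]) fact+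
  have [measurable]: "(\<lambda>\<omega>. t (accessed (\<theta> \<omega>)) j (w \<omega>)) \<in> borel_measurable M" for j
    by (rule measurable_compose_countable[where f = "\<lambda>i \<omega>. t i j (w \<omega>)"]) fact+
  show ?thesis
    unfolding *
  proof (rule measurable_compose_countable[where g = "\<lambda>\<omega>. J (\<theta> \<omega>)"])
    fix oj :: "'d option"
    show "(\<lambda>\<omega>. case oj of
      None \<Rightarrow> A (\<theta> \<omega>) *v g (accessed (\<theta> \<omega>)) (w \<omega>) + B (\<theta> \<omega>) *v w \<omega> + c (\<theta> \<omega>)
    | Some j \<Rightarrow> w \<omega> + t (accessed (\<theta> \<omega>)) j (w \<omega>) *\<^sub>R axis j 1) \<in> borel_measurable M"
      by (cases oj) simp_all
  qed simp_all
qed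

lemma gradient_eqI:
  assumes "GDERIV f x :> D"
  shows "gradient f x = D"
  unfolding gradient_def
proof (rule the_equality)
  fix D' assume "GDERIV f x :> D'"
  with assms have "(\<lambda>h. inner h D) = (\<lambda>h. inner h D')"
    unfolding gderiv_def by (rule has_derivative_unique)
  then show "D' = D"
    by (metis inner_commute vector_eq_ldot)
qed (fact assms)

primrec run ::
  "(nat \<Rightarrow> real^'d \<Rightarrow> real^'d) \<Rightarrow> (nat \<Rightarrow> 'd::finite \<Rightarrow> real^'d \<Rightarrow> real) \<Rightarrow> ('w, 'd) cli \<Rightarrow> nat \<Rightarrow> nat \<Rightarrow> 'w \<Rightarrow> real^'d"
where
  "run g t a 0 i \<omega> = init a i"
| "run g t a (Suc k) i \<omega> = (\<Sum>j\<in>points a. oracle_step g t (run g t a k j \<omega>) (params a k i j \<omega>))"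

text \<open>
  A complexity bound says nothing about an algorithm that has no runs, because then every iteration
  count succeeds vacuously. The lower bound therefore needs an actual run on each hard problem.
\<close>

lemma cli_run_run:
  fixes a :: "('w, 'd::finite) cli"
  assumes a: "oblivious_cli n a"
    and grad: "\<And>i w. GDERIV (f i) w :> g i w"
    and argmin: "\<And>i j w. is_arg_min (\<lambda>s. f i (w + s *\<^sub>R axis j 1)) (\<lambda>_. True) (t i j w)"
    and g: "\<And>i. continuous_on UNIV (g i)" and t: "\<And>i j. continuous_on UNIV (t i j)"
  shows "cli_run f a (run g t a)"
proof -
  have fin: "finite (points a)"
    using a by (simp add: oblivious_cli_def)
  have "run g t a k i \<in> borel_measurable (space_of a)" if "i \<in> points a" for k i
    using that
  proof (induction k arbitrary: i)
    case 0
    then show ?case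
      by (simp add: run.simps(1)[abs_def])
  next
    case (Suc k)
    have "(\<lambda>\<omega>. \<Sum>j\<in>points a. oracle_step g t (run g t a k j \<omega>) (params a k i j \<omega>))
        \<in> borel_measurable (space_of a)"
      using a Suc unfolding oblivious_cli_def
      by (intro borel_measurable_sum measurable_oracle_step g t) auto
    then show ?case
      by (subst measurable_cong[where g = "\<lambda>\<omega>. \<Sum>j\<in>points a.
        oracle_step g t (run g t a k j \<omega>) (params a k i j \<omega>)"]) simp_all
  qed
  moreover have "oracle_step g t w \<theta> \<in> oracle_answers f w \<theta>" for w \<theta>
    using argmin by (cases \<theta>) (auto simp: gradient_eqI[OF grad])
  ultimately show ?thesis
    unfolding cli_run_def
    by (auto simp: set_sum_alt[OF fin] intro!: always_eventually)
qed

section \<open>Components that are rarely accessed\<close>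

text \<open>
  All parameters of an iteration access the same component, so those from point \<open>1\<close> to itself suffice
  for the count.
\<close>

definition hits :: "nat set \<Rightarrow> ('w, 'd::finite) cli \<Rightarrow> nat \<Rightarrow> 'w \<Rightarrow> nat" where
  "hits S a k \<omega> = (\<Sum>l<k. of_bool (accessed (params a l 1 1 \<omega>) \<in> S))"

lemma accessed_eq:
  assumes "oblivious_cli n a" "\<omega> \<in> space (space_of a)" "i \<in> points a" "j \<in> points a"
  shows "accessed (params a k i j \<omega>) = accessed (params a k 1 1 \<omega>)"
  using assms unfolding oblivious_cli_def by metis

lemma accessed_range:
  assumes "oblivious_cli n a" "\<omega> \<in> space (space_of a)"
  shows "accessed (params a k 1 1 \<omega>) \<in> {1..n}"
  using assms unfolding oblivious_cli_def by metis

lemma sets_hits_le: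
  assumes "oblivious_cli n a"
  shows "{\<omega> \<in> space (space_of a). hits S a k \<omega> \<le> T} \<in> sets (space_of a)"
proof -
  have "params a l 1 1 \<in> space_of a \<rightarrow>\<^sub>M param_space" for l
    using assms by (simp add: oblivious_cli_def)
  from measurable_compose[OF this measurable_accessed]
  have [measurable]: "(\<lambda>\<omega>. accessed (params a l 1 1 \<omega>)) \<in> space_of a \<rightarrow>\<^sub>M count_space UNIV" for l .
  have "(\<lambda>\<omega>. (\<Sum>l<k. of_bool (accessed (params a l 1 1 \<omega>) \<in> S)) :: real) \<in> borel_measurable (space_of a)"
    by measurable
  then have "(\<lambda>\<omega>. real (hits S a k \<omega>)) \<in> borel_measurable (space_of a)"
    by (simp add: hits_def)
  then have "{\<omega> \<in> space (space_of a). real (hits S a k \<omega>) \<le> real T} \<in> sets (space_of a)"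
    by measurable
  then show ?thesis by simp
qed

text \<open>
  Summed over \<open>i\<close>, the number of accesses to the sets \<open>S i\<close> in \<open>k\<close> iterations is at most \<open>r * k\<close> in
  every outcome. If all sets had more than \<open>T\<close> accesses with probability above \<open>1/2\<close>, the expected
  total would exceed \<open>(T + 1) * n / 2\<close>.
\<close>

lemma rarely_accessed_set:
  fixes a :: "('w, 'd::finite) cli"
  assumes a: "oblivious_cli n a" and n: "n > 0"
    and cover: "\<And>m. m \<in> {1..n} \<Longrightarrow> card {i \<in> {1..n}. m \<in> S i} \<le> r"
    and T: "2 * r * k \<le> (T + 1) * n"
  obtains i where "i \<in> {1..n}"
    "measure (space_of a) {\<omega> \<in> space (space_of a). hits (S i) a k \<omega> \<le> T} \<ge> 1 / 2"
proof -
  interpret prob_space "space_of a"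
    using a by (simp add: oblivious_cli_def)
  let ?B = "\<lambda>i. {\<omega> \<in> space (space_of a). \<not> hits (S i) a k \<omega> \<le> T}"
  have B: "?B i \<in> sets (space_of a)" for i
    using sets_hits_le[OF a] by (rule sets.sets_Collect_neg)
  have pointwise: "(\<Sum>i=1..n. real (T + 1) * indicator (?B i) \<omega>) \<le> real (r * k)" if \<omega>: "\<omega> \<in> space (space_of a)" for \<omega>
  proof -
    have "(\<Sum>i=1..n. real (T + 1) * indicator (?B i) \<omega>) \<le> (\<Sum>i=1..n. real (hits (S i) a k \<omega>))"
      by (intro sum_mono) (auto simp: indicator_def)
    also have "\<dots> = real (\<Sum>l<k. \<Sum>i=1..n. of_bool (accessed (params a l 1 1 \<omega>) \<in> S i))"
      unfolding hits_def of_nat_sum by (rule sum.swap)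
    also have "(\<Sum>l<k. \<Sum>i=1..n. of_bool (accessed (params a l 1 1 \<omega>) \<in> S i)) \<le> (\<Sum>l<k. r)"
    proof (rule sum_mono)
      fix l
      have "(\<Sum>i=1..n. of_bool (accessed (params a l 1 1 \<omega>) \<in> S i))
          = card {i \<in> {1..n}. accessed (params a l 1 1 \<omega>) \<in> S i}"
        by (simp add: of_bool_def sum.If_cases Int_def)
      also have "\<dots> \<le> r"
        by (rule cover[OF accessed_range[OF a \<omega>]])
      finally show "(\<Sum>i=1..n. of_bool (accessed (params a l 1 1 \<omega>) \<in> S i)) \<le> r" .
    qed
    finally show ?thesis by (simp add: mult.commute)
  qed
  have "(\<Sum>i=1..n. real (T + 1) * prob (?B i))
      = (\<integral>\<omega>. (\<Sum>i=1..n. real (T + 1) * indicator (?B i) \<omega>) \<partial>space_of a)"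
    using B by (subst Bochner_Integration.integral_sum)
      (auto simp: less_top[symmetric])
  also have "\<dots> \<le> (\<integral>\<omega>. real (r * k) \<partial>space_of a)"
    using B pointwise by (intro integral_mono Bochner_Integration.integrable_sum)
      (auto simp: less_top[symmetric])
  also have "\<dots> = real (r * k)"
    by (simp add: prob_space)
  also have "\<dots> \<le> real ((T + 1) * n) / 2"
    using of_nat_mono[OF T, where 'a = real] by (simp add: mult.assoc)
  finally have avg: "(\<Sum>i=1..n. real (T + 1) * prob (?B i)) \<le> (\<Sum>i=1..n. real (T + 1) * (1 / 2))"
    by (simp add: algebra_simps)
  have "\<exists>i\<in>{1..n}. real (T + 1) * prob (?B i) \<le> real (T + 1) * (1 / 2)"
  proof (rule ccontr)
    assume "\<not> ?thesis"
    then have "(\<Sum>i=1..n. real (T + 1) * (1 / 2)) < (\<Sum>i=1..n. real (T + 1) * prob (?B i))"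
      using n by (intro sum_strict_mono) (auto simp: not_le)
    with avg show False by simp
  qed
  then obtain i where i: "i \<in> {1..n}" "prob (?B i) \<le> 1 / 2"
    by (auto simp del: of_nat_add of_nat_Suc)
  have "prob {\<omega> \<in> space (space_of a). hits (S i) a k \<omega> \<le> T} = 1 - prob (?B i)"
    using prob_neg[OF sets_hits_le[OF a, of "S i" k T]] by simp
  with i that show thesis by simp
qed

section \<open>Two families of problems that an oblivious algorithm confuses\<close>

lemma second_moment_of_eps_solution:
  assumes sol: "eps_solution \<epsilon> M F W" and X: "X \<in> borel_measurable M" and \<mu>: "\<mu> > 0" and \<epsilon>: "\<epsilon> > 0"
    and growth: "\<And>\<omega>. \<mu> / 2 * (X \<omega>)\<^sup>2 \<le> F (W \<omega>) - (INF w. F w)"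
  shows "integrable M (\<lambda>\<omega>. (X \<omega>)\<^sup>2)" and "(\<integral>\<omega>. (X \<omega>)\<^sup>2 \<partial>M) \<le> 2 * \<epsilon> / \<mu>"
proof -
  note X [measurable]
  have "(\<integral>\<^sup>+\<omega>. ennreal (\<mu> / 2 * (X \<omega>)\<^sup>2) \<partial>M) \<le> (\<integral>\<^sup>+\<omega>. ennreal (F (W \<omega>) - (INF w. F w)) \<partial>M)"
    by (intro nn_integral_mono ennreal_leI growth)
  also have "\<dots> < ennreal \<epsilon>"
    using sol by (simp add: eps_solution_def)
  finally have less: "(\<integral>\<^sup>+\<omega>. ennreal (\<mu> / 2 * (X \<omega>)\<^sup>2) \<partial>M) < ennreal \<epsilon>" .
  have int: "integrable M (\<lambda>\<omega>. \<mu> / 2 * (X \<omega>)\<^sup>2)"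
    using less \<mu> by (intro integrableI_nonneg) (auto intro: less_trans[OF _ ennreal_less_top])
  from integrable_mult_right[OF this, of "2 / \<mu>"] \<mu> show "integrable M (\<lambda>\<omega>. (X \<omega>)\<^sup>2)"
    by simp
  have "ennreal (\<integral>\<omega>. \<mu> / 2 * (X \<omega>)\<^sup>2 \<partial>M) < ennreal \<epsilon>"
    using less \<mu> int by (subst nn_integral_eq_integral[symmetric]) auto
  then have "\<mu> / 2 * (\<integral>\<omega>. (X \<omega>)\<^sup>2 \<partial>M) < \<epsilon>"
    using \<mu> by (subst (asm) ennreal_less_iff) auto
  then show "(\<integral>\<omega>. (X \<omega>)\<^sup>2 \<partial>M) \<le> 2 * \<epsilon> / \<mu>"
    using \<mu> by (simp add: field_simps)
qed

text \<open>
  Linearizes the passage from second to first moments: with \<open>\<tau>\<^sup>2\<close> a bound of the second moment, the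
  expectation of the right-hand side is at most \<open>\<tau>\<close>.
\<close>

lemma abs_le_square_average:
  fixes x \<tau> :: real
  assumes "\<tau> > 0"
  shows "\<bar>x\<bar> \<le> x\<^sup>2 / (2 * \<tau>) + \<tau> / 2"
proof -
  have "0 \<le> (\<bar>x\<bar> - \<tau>)\<^sup>2 / (2 * \<tau>)"
    using assms by simp
  also have "\<dots> = x\<^sup>2 / (2 * \<tau>) + \<tau> / 2 - \<bar>x\<bar>"
    using assms by (simp add: power2_eq_square field_simps)
  finally show ?thesis by simp
qed

text \<open>
  The functions \<open>f s \<eta>\<close> for the signs \<open>s\<close> and the parameters \<open>\<eta> \<in> H\<close> are the problems that are compared,
  with gradients \<open>g\<close> and line minimizers \<open>t\<close>. The set \<open>S\<close> contains the components that depend on \<open>\<eta>\<close>: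
  an access to them costs one degree. The last two assumptions say that the answers no longer reveal
  the sign at \<open>\<eta> = 0\<close>, a parameter that need not belong to \<open>H\<close>: there \<open>t\<close> is the continuation of
  the polynomial formula and need not be a minimizer.
\<close>

locale polynomial_family =
  fixes f :: "real \<Rightarrow> real \<Rightarrow> nat \<Rightarrow> real^'d::finite \<Rightarrow> real"
    and g :: "real \<Rightarrow> real \<Rightarrow> nat \<Rightarrow> real^'d \<Rightarrow> real^'d"
    and t :: "real \<Rightarrow> real \<Rightarrow> nat \<Rightarrow> 'd \<Rightarrow> real^'d \<Rightarrow> real"
    and S :: "nat set" and H :: "real set"
  assumes gderiv: "\<eta> \<in> H \<Longrightarrow> s \<in> {1, -1} \<Longrightarrow> GDERIV (f s \<eta> i) w :> g s \<eta> i w"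
    and argmin: "\<eta> \<in> H \<Longrightarrow> s \<in> {1, -1} \<Longrightarrow>
      is_arg_min (\<lambda>x. f s \<eta> i (w + x *\<^sub>R axis j 1)) (\<lambda>_. True) (t s \<eta> i j w)"
    and continuous_gradient: "continuous_on UNIV (g s \<eta> i)"
    and continuous_displacement: "continuous_on UNIV (t s \<eta> i j)"
    and poly_gradient: "poly_curve m y \<Longrightarrow> poly_curve (m + of_bool (i \<in> S)) (\<lambda>\<eta>. g s \<eta> i (y \<eta>))"
    and poly_displacement: "poly_curve m y \<Longrightarrow> poly_curve (m + of_bool (i \<in> S)) (\<lambda>\<eta>. t s \<eta> i j (y \<eta>))"
    and gradient_at_0: "g s 0 i w = g s' 0 i w"
    and displacement_at_0: "t s 0 i j w = t s' 0 i j w"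
begin

abbreviation trajectory :: "('w, 'd) cli \<Rightarrow> real \<Rightarrow> real \<Rightarrow> nat \<Rightarrow> nat \<Rightarrow> 'w \<Rightarrow> real^'d" where
  "trajectory a s \<eta> \<equiv> run (g s \<eta>) (t s \<eta>) a"

lemma cli_run_trajectory:
  assumes "oblivious_cli n a" "\<eta> \<in> H" "s \<in> {1, -1}"
  shows "cli_run (f s \<eta>) a (trajectory a s \<eta>)"
  using assms
  by (intro cli_run_run gderiv argmin continuous_gradient continuous_displacement)

lemma poly_oracle_step:
  assumes "poly_curve m w"
  shows "poly_curve (m + of_bool (accessed \<theta> \<in> S)) (\<lambda>\<eta>. oracle_step (g s \<eta>) (t s \<eta>) (w \<eta>) \<theta>)"
proof -
  have w: "poly_curve (m + of_bool b) w" for b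
    using assms by (rule poly_curve_mono) simp
  note rules = poly_curve_add poly_curve_matrix poly_curve_const poly_curve_times_vector w
  show ?thesis
  proof (cases \<theta>)
    case (First_Order A B c i)
    show ?thesis
      unfolding First_Order oracle_step.simps accessed.simps
      by (intro rules poly_gradient assms)
  next
    case (Coordinate_Descent j i)
    show ?thesis
      unfolding Coordinate_Descent oracle_step.simps accessed.simps
      by (intro rules poly_displacement assms)
  qed
qed

lemma poly_trajectory:
  assumes a: "oblivious_cli n a" and \<omega>: "\<omega> \<in> space (space_of a)" and i: "i \<in> points a"
  shows "poly_curve (hits S a k \<omega>) (\<lambda>\<eta>. trajectory a s \<eta> k i \<omega>)"
  using i
proof (induction k arbitrary: i)
  case 0
  then show ?case by (simp add: poly_curve_const)
next
  case (Suc k)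
  have "poly_curve (hits S a k \<omega> + of_bool (accessed (params a k i j \<omega>) \<in> S))
      (\<lambda>\<eta>. oracle_step (g s \<eta>) (t s \<eta>) (trajectory a s \<eta> k j \<omega>) (params a k i j \<omega>))" if "j \<in> points a" for j
    using Suc.IH[OF that] by (rule poly_oracle_step)
  then show ?case
    using Suc.prems by (auto simp: hits_def accessed_eq[OF a \<omega>] intro!: poly_curve_sum)
qed

lemma trajectory_at_0: "trajectory a s 0 k i \<omega> = trajectory a s' 0 k i \<omega>"
proof -
  have "oracle_step (g s 0) (t s 0) w \<theta> = oracle_step (g s' 0) (t s' 0) w \<theta>" for w \<theta>
    by (cases \<theta>) (simp_all add: gradient_at_0[of s _ _ s'] displacement_at_0[of s _ _ _ s'])
  then show ?thesis
    by (induction k arbitrary: i) simp_all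
qed

text \<open>
  Along \<open>v\<close> the minimizers of the two versions are \<open>2 * \<rho>\<close> apart. In an outcome with at most \<open>T\<close>
  accesses to \<open>S\<close>, the difference of the two runs along \<open>v\<close> is a polynomial \<open>q\<close> of degree at most \<open>T\<close>
  with \<open>q(0) = 0\<close>, and the interpolation formula expresses \<open>2 * \<rho>\<close> as a combination of the errors at
  the nodes. Such outcomes have probability at least \<open>1/2\<close>. The expected error at \<open>x j\<close> is at most
  \<open>sqrt (2 * \<epsilon> / \<mu> (x j))\<close> for either sign, by the quadratic growth along \<open>v\<close> with constant \<open>\<mu> (x j)\<close>.
\<close>

lemma separation_bound:
  fixes a :: "('w, 'd) cli"
  assumes a: "oblivious_cli n a" and \<epsilon>: "\<epsilon> > 0" and J: "finite J"
    and nodes: "\<And>j. j \<in> J \<Longrightarrow> x j \<in> H"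
    and interpolation: "\<And>q :: real poly. degree q \<le> T \<Longrightarrow> poly q 0 = (\<Sum>j\<in>J. c j * poly q (x j))"
    and solved: "\<And>\<eta> s W. \<eta> \<in> H \<Longrightarrow> s \<in> {1, -1} \<Longrightarrow> cli_run (f s \<eta>) a W \<Longrightarrow>
      eps_solution \<epsilon> (space_of a) (finite_sum n (f s \<eta>)) (W k 1)"
    and \<mu>: "\<And>\<eta>. \<eta> \<in> H \<Longrightarrow> \<mu> \<eta> > 0"
    and growth: "\<And>\<eta> s w. \<eta> \<in> H \<Longrightarrow> s \<in> {1, -1} \<Longrightarrow>
      \<mu> \<eta> / 2 * (v \<bullet> (w - x\<^sub>0) - s * \<rho>)\<^sup>2 \<le> finite_sum n (f s \<eta>) w - (INF w. finite_sum n (f s \<eta>) w)"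
    and rare: "measure (space_of a) {\<omega> \<in> space (space_of a). hits S a k \<omega> \<le> T} \<ge> 1 / 2"
    and \<rho>: "\<rho> \<ge> 0"
  shows "\<rho> \<le> 2 * (\<Sum>j\<in>J. \<bar>c j\<bar> * sqrt (2 * \<epsilon> / \<mu> (x j)))"
proof -
  interpret prob_space "space_of a"
    using a by (simp add: oblivious_cli_def)
  define E where "E = {\<omega> \<in> space (space_of a). hits S a k \<omega> \<le> T}"
  have E: "E \<in> sets (space_of a)"
    unfolding E_def by (rule sets_hits_le[OF a])
  define X where "X s j \<omega> = v \<bullet> (trajectory a s (x j) k 1 \<omega> - x\<^sub>0) - s * \<rho>" for s j \<omega>
  define \<tau> where "\<tau> j = sqrt (2 * \<epsilon> / \<mu> (x j))" for j
  have \<tau>: "\<tau> j > 0" "2 * \<epsilon> / \<mu> (x j) = (\<tau> j)\<^sup>2" if "j \<in> J" for j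
    using \<mu>[OF nodes[OF that]] \<epsilon> by (simp_all add: \<tau>_def)
  have moment: "integrable (space_of a) (\<lambda>\<omega>. (X s j \<omega>)\<^sup>2)" "expectation (\<lambda>\<omega>. (X s j \<omega>)\<^sup>2) \<le> (\<tau> j)\<^sup>2"
    if s: "s \<in> {1, -1}" and j: "j \<in> J" for s j
  proof -
    have run: "cli_run (f s (x j)) a (trajectory a s (x j))"
      using cli_run_trajectory[OF a nodes[OF j] s] .
    have "1 \<in> points a"
      using a by (simp add: oblivious_cli_def)
    with run have "trajectory a s (x j) k 1 \<in> borel_measurable (space_of a)"
      by (simp add: cli_run_def)
    then have "X s j \<in> borel_measurable (space_of a)"
      unfolding X_def by measurable
    note second_moment_of_eps_solution[OF solved[OF nodes[OF j] s run] this \<mu>[OF nodes[OF j]] \<epsilon>]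
    note this[unfolded X_def, OF growth[OF nodes[OF j] s], folded X_def]
    then show "integrable (space_of a) (\<lambda>\<omega>. (X s j \<omega>)\<^sup>2)" "expectation (\<lambda>\<omega>. (X s j \<omega>)\<^sup>2) \<le> (\<tau> j)\<^sup>2"
      using \<tau>[OF j] by simp_all
  qed
  \<comment> \<open>An integrable bound of the \<open>j\<close>-th term in the interpolation formula.\<close>
  define Y where "Y j \<omega> = \<bar>c j\<bar> * (((X 1 j \<omega>)\<^sup>2 + (X (-1) j \<omega>)\<^sup>2) / (2 * \<tau> j) + \<tau> j)" for j \<omega>
  have Y_nonneg: "Y j \<omega> \<ge> 0" if "j \<in> J" for j \<omega>
    using \<tau>(1)[OF that] by (auto simp: Y_def intro!: mult_nonneg_nonneg add_nonneg_nonneg divide_nonneg_nonneg)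
  have "2 * \<rho> * indicator E \<omega> \<le> (\<Sum>j\<in>J. Y j \<omega>)" if \<omega>: "\<omega> \<in> space (space_of a)" for \<omega>
  proof (cases "\<omega> \<in> E")
    case True
    have "poly_curve T (\<lambda>\<eta>. trajectory a s \<eta> k 1 \<omega>)" for s
      using True a by (intro poly_curve_mono[OF poly_trajectory[OF a \<omega>]]) (auto simp: E_def oblivious_cli_def)
    then have "poly_curve T (\<lambda>\<eta>. trajectory a 1 \<eta> k 1 \<omega> - trajectory a (-1) \<eta> k 1 \<omega>)"
      by (intro poly_curve_diff)
    then obtain q :: "real poly" where q: "degree q \<le> T"
      "\<And>\<eta>. v \<bullet> (trajectory a 1 \<eta> k 1 \<omega> - trajectory a (-1) \<eta> k 1 \<omega>) = poly q \<eta>"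
      unfolding poly_curve_def by metis
    have "poly q 0 = 0"
      using q(2)[of 0] by (simp add: trajectory_at_0[where s = 1 and s' = "-1"])
    moreover have "poly q (x j) = X 1 j \<omega> - X (-1) j \<omega> + 2 * \<rho>" for j
      by (simp add: q(2)[symmetric] X_def inner_diff_right)
    moreover have "(\<Sum>j\<in>J. c j) = 1"
      using interpolation[of 1] by simp
    \<comment> \<open>The weights sum up to one, so the constant \<open>2 * \<rho>\<close> passes through the interpolation formula.\<close>
    ultimately have "0 = (\<Sum>j\<in>J. c j * (X 1 j \<omega> - X (-1) j \<omega>)) + 2 * \<rho>"
      using interpolation[OF q(1)]
      by (simp add: distrib_left sum.distrib sum_distrib_right[symmetric])
    then have "2 * \<rho> \<le> \<bar>\<Sum>j\<in>J. c j * (X 1 j \<omega> - X (-1) j \<omega>)\<bar>"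
      by linarith
    also have "\<dots> \<le> (\<Sum>j\<in>J. \<bar>c j * (X 1 j \<omega> - X (-1) j \<omega>)\<bar>)"
      by (rule sum_abs)
    also have "\<dots> \<le> (\<Sum>j\<in>J. Y j \<omega>)"
    proof (rule sum_mono)
      fix j assume "j \<in> J"
      have "\<bar>X 1 j \<omega> - X (-1) j \<omega>\<bar> \<le> \<bar>X 1 j \<omega>\<bar> + \<bar>X (-1) j \<omega>\<bar>"
        by simp
      also have "\<dots> \<le> ((X 1 j \<omega>)\<^sup>2 + (X (-1) j \<omega>)\<^sup>2) / (2 * \<tau> j) + \<tau> j"
        using abs_le_square_average[OF \<tau>(1)[OF \<open>j \<in> J\<close>], of "X 1 j \<omega>"]
          abs_le_square_average[OF \<tau>(1)[OF \<open>j \<in> J\<close>], of "X (-1) j \<omega>"]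
        by (simp add: add_divide_distrib)
      finally show "\<bar>c j * (X 1 j \<omega> - X (-1) j \<omega>)\<bar> \<le> Y j \<omega>"
        unfolding Y_def abs_mult by (intro mult_left_mono) auto
    qed
    finally show ?thesis
      using True by simp
  qed (auto intro!: sum_nonneg Y_nonneg)
  moreover have int_Y: "integrable (space_of a) (Y j)" if "j \<in> J" for j
    unfolding Y_def using moment[OF _ that] by auto
  ultimately have "(\<integral>\<omega>. 2 * \<rho> * indicator E \<omega> \<partial>space_of a) \<le> (\<integral>\<omega>. (\<Sum>j\<in>J. Y j \<omega>) \<partial>space_of a)"
    using E by (intro integral_mono Bochner_Integration.integrable_sum)
      (auto simp: less_top[symmetric])
  also have "\<dots> = (\<Sum>j\<in>J. expectation (Y j))"
    using int_Y by (rule Bochner_Integration.integral_sum)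
  also have "\<dots> \<le> (\<Sum>j\<in>J. 2 * (\<bar>c j\<bar> * \<tau> j))"
  proof (rule sum_mono)
    fix j assume j: "j \<in> J"
    have "expectation (Y j) = \<bar>c j\<bar> * ((expectation (\<lambda>\<omega>. (X 1 j \<omega>)\<^sup>2) + expectation (\<lambda>\<omega>. (X (-1) j \<omega>)\<^sup>2)) / (2 * \<tau> j) + \<tau> j)"
      unfolding Y_def using moment(1)[OF _ j] by (simp add: prob_space)
    also have "\<dots> \<le> \<bar>c j\<bar> * (((\<tau> j)\<^sup>2 + (\<tau> j)\<^sup>2) / (2 * \<tau> j) + \<tau> j)"
      using moment(2)[OF _ j] \<tau>(1)[OF j]
      by (intro mult_left_mono add_right_mono divide_right_mono add_mono) auto
    also have "\<dots> = 2 * (\<bar>c j\<bar> * \<tau> j)"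
      using \<tau>(1)[OF j] by (simp add: power2_eq_square)
    finally show "expectation (Y j) \<le> 2 * (\<bar>c j\<bar> * \<tau> j)" .
  qed
  also have "\<dots> = 2 * (\<Sum>j\<in>J. \<bar>c j\<bar> * \<tau> j)"
    by (rule sum_distrib_left[symmetric])
  finally have "2 * \<rho> * prob E \<le> 2 * (\<Sum>j\<in>J. \<bar>c j\<bar> * \<tau> j)"
    using E by simp
  moreover have "2 * \<rho> * (1 / 2) \<le> 2 * \<rho> * prob E"
    using rare \<rho> unfolding E_def by (intro mult_left_mono) auto
  ultimately show ?thesis
    by (simp add: \<tau>_def)
qed

end

section \<open>Quadratic components that depend on two directions\<close>

text \<open>
  All hard components have this form with orthogonal directions \<open>v\<close> and \<open>u\<close>, where \<open>u = 0\<close> if a single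
  direction suffices. Only the centre \<open>z\<close> along \<open>v\<close> varies.
\<close>

definition bowl :: "'a::real_inner \<Rightarrow> 'a \<Rightarrow> 'a \<Rightarrow> real \<Rightarrow> real \<Rightarrow> real \<Rightarrow> 'a \<Rightarrow> real" where
  "bowl x\<^sub>0 v u p q z w = p / 2 * (v \<bullet> (w - x\<^sub>0) - z)\<^sup>2 + q / 2 * (u \<bullet> (w - x\<^sub>0))\<^sup>2"

definition bowl_gradient :: "'a::real_inner \<Rightarrow> 'a \<Rightarrow> 'a \<Rightarrow> real \<Rightarrow> real \<Rightarrow> real \<Rightarrow> 'a \<Rightarrow> 'a" where
  "bowl_gradient x\<^sub>0 v u p q z w = (p * (v \<bullet> (w - x\<^sub>0) - z)) *\<^sub>R v + (q * (u \<bullet> (w - x\<^sub>0))) *\<^sub>R u"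

lemma gderiv_bowl: "GDERIV (bowl x\<^sub>0 v u p q z) w :> bowl_gradient x\<^sub>0 v u p q z w"
  unfolding gderiv_def bowl_def bowl_gradient_def
  by (auto intro!: derivative_eq_intros simp: inner_commute inner_add_right inner_diff_right field_simps)

lemma convex_on_square_of_affine:
  fixes v :: "'a::real_inner"
  assumes "p \<ge> 0"
  shows "convex_on UNIV (\<lambda>w. p / 2 * (v \<bullet> (w - x\<^sub>0) - z)\<^sup>2)"
proof (rule convex_onI)
  fix r :: real and x y :: 'a
  assume r: "0 < r" "r < 1"
  define X Y where "X = v \<bullet> (x - x\<^sub>0) - z" and "Y = v \<bullet> (y - x\<^sub>0) - z"
  have "v \<bullet> ((1 - r) *\<^sub>R x + r *\<^sub>R y - x\<^sub>0) - z = (1 - r) * X + r * Y"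
    by (simp add: X_def Y_def inner_diff_right inner_add_right algebra_simps)
  moreover have "(1 - r) * X\<^sup>2 + r * Y\<^sup>2 - ((1 - r) * X + r * Y)\<^sup>2 = r * (1 - r) * (X - Y)\<^sup>2"
    by (simp add: power2_eq_square algebra_simps)
  moreover have "r * (1 - r) * (X - Y)\<^sup>2 \<ge> 0"
    using r by simp
  ultimately have "(v \<bullet> ((1 - r) *\<^sub>R x + r *\<^sub>R y - x\<^sub>0) - z)\<^sup>2 \<le> (1 - r) * X\<^sup>2 + r * Y\<^sup>2"
    by simp
  moreover have "(1 - r) * (p / 2 * X\<^sup>2) + r * (p / 2 * Y\<^sup>2) = p / 2 * ((1 - r) * X\<^sup>2 + r * Y\<^sup>2)"
    by (simp add: field_simps)
  ultimately show "p / 2 * (v \<bullet> ((1 - r) *\<^sub>R x + r *\<^sub>R y - x\<^sub>0) - z)\<^sup>2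
      \<le> (1 - r) * (p / 2 * (v \<bullet> (x - x\<^sub>0) - z)\<^sup>2) + r * (p / 2 * (v \<bullet> (y - x\<^sub>0) - z)\<^sup>2)"
    unfolding X_def[symmetric] Y_def[symmetric] using assms by (auto intro: mult_left_mono)
qed simp

lemma convex_on_bowl: "p \<ge> 0 \<Longrightarrow> q \<ge> 0 \<Longrightarrow> convex_on UNIV (bowl x\<^sub>0 v u p q z)"
  using convex_on_add[OF convex_on_square_of_affine[of p v x\<^sub>0 z] convex_on_square_of_affine[of q u x\<^sub>0 0]]
  by (simp add: bowl_def[abs_def])

lemma bessel_pair:
  fixes v u :: "'a::real_inner"
  assumes "norm v \<le> 1" "norm u \<le> 1" "v \<bullet> u = 0"
  shows "(v \<bullet> w)\<^sup>2 + (u \<bullet> w)\<^sup>2 \<le> (norm w)\<^sup>2"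
proof -
  define P Q where "P = v \<bullet> w" and "Q = u \<bullet> w"
  have le: "v \<bullet> v \<le> 1" "u \<bullet> u \<le> 1"
    using assms by (simp_all add: norm_le_square)
  have "0 \<le> (w - P *\<^sub>R v - Q *\<^sub>R u) \<bullet> (w - P *\<^sub>R v - Q *\<^sub>R u)"
    by simp
  also have "\<dots> = w \<bullet> w - 2 * P\<^sup>2 - 2 * Q\<^sup>2 + P\<^sup>2 * (v \<bullet> v) + Q\<^sup>2 * (u \<bullet> u)"
    using assms(3) by (simp add: P_def Q_def inner_diff_left inner_diff_right inner_commute power2_eq_square algebra_simps)
  also have "\<dots> \<le> w \<bullet> w - 2 * P\<^sup>2 - 2 * Q\<^sup>2 + P\<^sup>2 * 1 + Q\<^sup>2 * 1"
    using le by (intro add_mono mult_left_mono) auto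
  finally show ?thesis
    by (simp add: P_def Q_def power2_norm_eq_inner)
qed

lemma lipschitz_bowl_gradient:
  fixes v u :: "'a::real_inner"
  assumes vu: "norm v \<le> 1" "norm u \<le> 1" "v \<bullet> u = 0" and p: "0 \<le> p" "p \<le> L" and q: "0 \<le> q" "q \<le> L"
  shows "L-lipschitz_on UNIV (bowl_gradient x\<^sub>0 v u p q z)"
proof (rule lipschitz_onI)
  show "0 \<le> L" using p by simp
  fix x y :: 'a
  define P Q where "P = v \<bullet> (x - y)" and "Q = u \<bullet> (x - y)"
  have "bowl_gradient x\<^sub>0 v u p q z x - bowl_gradient x\<^sub>0 v u p q z y = (p * P) *\<^sub>R v + (q * Q) *\<^sub>R u"
    by (simp add: bowl_gradient_def P_def Q_def inner_diff_right algebra_simps)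
  then have "(dist (bowl_gradient x\<^sub>0 v u p q z x) (bowl_gradient x\<^sub>0 v u p q z y))\<^sup>2
      = (p * P)\<^sup>2 * (v \<bullet> v) + (q * Q)\<^sup>2 * (u \<bullet> u)"
    using vu(3) by (simp only: dist_norm power2_norm_eq_inner)
      (simp add: inner_add_left inner_add_right inner_commute power2_eq_square)
  also have "\<dots> \<le> (p * P)\<^sup>2 * 1 + (q * Q)\<^sup>2 * 1"
    using vu by (intro add_mono mult_left_mono) (auto simp: norm_le_square)
  also have "\<dots> \<le> L\<^sup>2 * P\<^sup>2 + L\<^sup>2 * Q\<^sup>2"
    using p q by (simp add: power_mult_distrib) (intro add_mono mult_right_mono power_mono, auto)
  also have "\<dots> \<le> L\<^sup>2 * (norm (x - y))\<^sup>2"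
    using mult_left_mono[OF bessel_pair[OF vu, of "x - y"], of "L\<^sup>2"] by (simp add: P_def Q_def distrib_left)
  finally have "(dist (bowl_gradient x\<^sub>0 v u p q z x) (bowl_gradient x\<^sub>0 v u p q z y))\<^sup>2 \<le> (L * dist x y)\<^sup>2"
    by (simp add: power_mult_distrib dist_norm)
  then show "dist (bowl_gradient x\<^sub>0 v u p q z x) (bowl_gradient x\<^sub>0 v u p q z y) \<le> L * dist x y"
    using p by (auto intro: power2_le_imp_le)
qed

lemma smooth_fun_bowl:
  fixes v u :: "'a::real_inner"
  assumes "norm v \<le> 1" "norm u \<le> 1" "v \<bullet> u = 0" "0 \<le> p" "p \<le> L" "0 \<le> q" "q \<le> L"
  shows "smooth_fun L (bowl x\<^sub>0 v u p q z)"
proof -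
  have "gradient (bowl x\<^sub>0 v u p q z) = bowl_gradient x\<^sub>0 v u p q z"
    by (intro ext gradient_eqI gderiv_bowl)
  then show ?thesis
    using lipschitz_bowl_gradient[OF assms] by (simp add: smooth_fun_def gderiv_bowl)
qed

lemma bowl_is_arg_min_on_line:
  fixes v u x\<^sub>0 w :: "real^'d::finite"
  assumes pq: "p \<ge> 0" "q \<ge> 0"
    and stationary: "p * (v \<bullet> (w - x\<^sub>0) - z + \<delta> * v $ j) * v $ j + q * (u \<bullet> (w - x\<^sub>0) + \<delta> * u $ j) * u $ j = 0"
  shows "is_arg_min (\<lambda>x. bowl x\<^sub>0 v u p q z (w + x *\<^sub>R axis j 1)) (\<lambda>_. True) \<delta>"
proof -
  define P Q a b where "P = v \<bullet> (w - x\<^sub>0) - z" and "Q = u \<bullet> (w - x\<^sub>0)" and "a = v $ j" and "b = u $ j"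
  have along: "bowl x\<^sub>0 v u p q z (w + x *\<^sub>R axis j 1) = p / 2 * (P + x * a)\<^sup>2 + q / 2 * (Q + x * b)\<^sup>2" for x
    by (simp add: bowl_def P_def Q_def a_def b_def inner_diff_right inner_add_right inner_axis algebra_simps)
  have "bowl x\<^sub>0 v u p q z (w + \<delta> *\<^sub>R axis j 1) \<le> bowl x\<^sub>0 v u p q z (w + x *\<^sub>R axis j 1)" for x
  proof -
    have "bowl x\<^sub>0 v u p q z (w + x *\<^sub>R axis j 1) - bowl x\<^sub>0 v u p q z (w + \<delta> *\<^sub>R axis j 1)
      = p / 2 * (a * (x - \<delta>))\<^sup>2 + q / 2 * (b * (x - \<delta>))\<^sup>2
        + (x - \<delta>) * (p * (P + \<delta> * a) * a + q * (Q + \<delta> * b) * b)"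
      unfolding along by (simp add: power2_eq_square algebra_simps)
    also have "p * (P + \<delta> * a) * a + q * (Q + \<delta> * b) * b = 0"
      using stationary by (simp add: P_def Q_def a_def b_def)
    finally have "bowl x\<^sub>0 v u p q z (w + x *\<^sub>R axis j 1) - bowl x\<^sub>0 v u p q z (w + \<delta> *\<^sub>R axis j 1)
      = p / 2 * (a * (x - \<delta>))\<^sup>2 + q / 2 * (b * (x - \<delta>))\<^sup>2"
      by simp
    moreover have "0 \<le> p / 2 * (a * (x - \<delta>))\<^sup>2 + q / 2 * (b * (x - \<delta>))\<^sup>2"
      using pq by simp
    ultimately show ?thesis
      by linarith
  qed
  then show ?thesis
    by (auto simp: is_arg_min_def not_less)
qed

lemma continuous_bowl_gradient: "continuous_on A (bowl_gradient x\<^sub>0 v u p q z)"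
  unfolding bowl_gradient_def by (intro continuous_intros)

lemma polynomial_family_bowl:
  fixes v u x\<^sub>0 :: "real^'d::finite"
  assumes nonneg: "\<And>s \<eta> i. \<eta> \<in> H \<Longrightarrow> s \<in> {1, -1} \<Longrightarrow> p s \<eta> i \<ge> 0"
      "\<And>s \<eta> i. \<eta> \<in> H \<Longrightarrow> s \<in> {1, -1} \<Longrightarrow> q s \<eta> i \<ge> 0"
    and stationary: "\<And>s \<eta> i j w. \<eta> \<in> H \<Longrightarrow> s \<in> {1, -1} \<Longrightarrow>
      p s \<eta> i * (v \<bullet> (w - x\<^sub>0) - z s \<eta> i + t s \<eta> i j w * v $ j) * v $ j
        + q s \<eta> i * (u \<bullet> (w - x\<^sub>0) + t s \<eta> i j w * u $ j) * u $ j = 0"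
    and continuous: "\<And>s \<eta> i j. continuous_on UNIV (t s \<eta> i j)"
    and poly_v: "\<And>m y s i. poly_curve m y \<Longrightarrow>
      poly_curve (m + of_bool (i \<in> S)) (\<lambda>\<eta>. p s \<eta> i * (v \<bullet> (y \<eta> - x\<^sub>0) - z s \<eta> i))"
    and poly_u: "\<And>m y s i. poly_curve m y \<Longrightarrow>
      poly_curve (m + of_bool (i \<in> S)) (\<lambda>\<eta>. q s \<eta> i * (u \<bullet> (y \<eta> - x\<^sub>0)))"
    and poly_t: "\<And>m y s i j. poly_curve m y \<Longrightarrow> poly_curve (m + of_bool (i \<in> S)) (\<lambda>\<eta>. t s \<eta> i j (y \<eta>))"
    and at_0: "\<And>s s' i. p s 0 i = p s' 0 i" "\<And>s s' i. p s 0 i * z s 0 i = p s' 0 i * z s' 0 i"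
      "\<And>s s' i. q s 0 i = q s' 0 i" "\<And>s s' i j w. t s 0 i j w = t s' 0 i j w"
  shows "polynomial_family (\<lambda>s \<eta> i. bowl x\<^sub>0 v u (p s \<eta> i) (q s \<eta> i) (z s \<eta> i))
    (\<lambda>s \<eta> i. bowl_gradient x\<^sub>0 v u (p s \<eta> i) (q s \<eta> i) (z s \<eta> i)) t S H"
proof
  show "poly_curve (m + of_bool (i \<in> S)) (\<lambda>\<eta>. bowl_gradient x\<^sub>0 v u (p s \<eta> i) (q s \<eta> i) (z s \<eta> i) (y \<eta>))"
    if "poly_curve m y" for m y s i
    unfolding bowl_gradient_def using that
    by (intro poly_curve_add poly_curve_times_vector poly_v poly_u)
  show "poly_curve (m + of_bool (i \<in> S)) (\<lambda>\<eta>. t s \<eta> i j (y \<eta>))" if "poly_curve m y" for m y s i j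
    using that by (rule poly_t)
  show "bowl_gradient x\<^sub>0 v u (p s 0 i) (q s 0 i) (z s 0 i) w
      = bowl_gradient x\<^sub>0 v u (p s' 0 i) (q s' 0 i) (z s' 0 i) w" for s s' i w
    unfolding bowl_gradient_def right_diff_distrib
    using at_0(1)[of s i s'] at_0(2)[of s i s'] at_0(3)[of s i s'] by simp
qed (use nonneg in \<open>auto intro!: gderiv_bowl bowl_is_arg_min_on_line stationary continuous_bowl_gradient
  continuous at_0(4)\<close>)

text \<open>
  The average is again a bowl plus a constant, and its centre \<open>\<zeta>\<close> is the mean of the centres weighted by
  the curvatures.
\<close>

lemma finite_sum_bowl:
  assumes n: "n > 0" and P: "(\<Sum>i=1..n. p i) = P" and \<zeta>: "(\<Sum>i=1..n. p i * z i) = P * \<zeta>"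
  shows "finite_sum n (\<lambda>i. bowl x\<^sub>0 v u (p i) (q i) (z i)) w
    = P / n / 2 * (v \<bullet> (w - x\<^sub>0) - \<zeta>)\<^sup>2 + (\<Sum>i=1..n. q i) / n / 2 * (u \<bullet> (w - x\<^sub>0))\<^sup>2
      + ((\<Sum>i=1..n. p i * (z i)\<^sup>2) - P * \<zeta>\<^sup>2) / n / 2"
proof -
  define y y' where "y = v \<bullet> (w - x\<^sub>0)" and "y' = u \<bullet> (w - x\<^sub>0)"
  have bowl: "bowl x\<^sub>0 v u (p i) (q i) (z i) w = p i / 2 * (y - z i)\<^sup>2 + q i / 2 * y'\<^sup>2" for i
    by (simp add: bowl_def y_def y'_def)
  have "(\<Sum>i=1..n. bowl x\<^sub>0 v u (p i) (q i) (z i) w)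
    = (\<Sum>i=1..n. y\<^sup>2 / 2 * p i - y * (p i * z i) + (p i * (z i)\<^sup>2) / 2 + y'\<^sup>2 / 2 * q i)"
    by (intro sum.cong) (simp_all add: bowl power2_eq_square field_simps)
  also have "\<dots> = y\<^sup>2 / 2 * P - y * (P * \<zeta>) + (\<Sum>i=1..n. p i * (z i)\<^sup>2) / 2 + y'\<^sup>2 / 2 * (\<Sum>i=1..n. q i)"
    by (simp only: sum.distrib sum_subtractf sum_distrib_left[symmetric] sum_divide_distrib[symmetric] P \<zeta>)
  also have "\<dots> = P / 2 * (y - \<zeta>)\<^sup>2 + (\<Sum>i=1..n. q i) / 2 * y'\<^sup>2 + ((\<Sum>i=1..n. p i * (z i)\<^sup>2) - P * \<zeta>\<^sup>2) / 2"
    by (simp add: power2_eq_square field_simps)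
  finally show ?thesis
    by (simp add: finite_sum_def y_def y'_def add_divide_distrib)
qed

lemma bowls_in_problems:
  fixes v u x\<^sub>0 :: "'a::real_inner"
  assumes n: "n > 0" and vu: "norm v = 1" "norm u \<le> 1" "v \<bullet> u = 0"
    and p: "\<And>i. 0 \<le> p i" "\<And>i. p i \<le> L" and q: "\<And>i. 0 \<le> q i" "\<And>i. q i \<le> L"
    and P: "(\<Sum>i=1..n. p i) = P" and \<zeta>: "(\<Sum>i=1..n. p i * z i) = P * \<zeta>" "\<bar>\<zeta>\<bar> \<le> R"
  defines "F \<equiv> finite_sum n (\<lambda>i. bowl x\<^sub>0 v u (p i) (q i) (z i))"
  shows "(\<lambda>i. bowl x\<^sub>0 v u (p i) (q i) (z i)) \<in> problems n L R x\<^sub>0"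
    and "P / n / 2 * (v \<bullet> (w - x\<^sub>0) - \<zeta>)\<^sup>2 \<le> F w - (INF w. F w)"
proof -
  \<comment> \<open>Orthogonality of \<open>u\<close> and \<open>v\<close> allows both squares to be minimal at the same point.\<close>
  define w' where "w' = x\<^sub>0 + \<zeta> *\<^sub>R v"
  have "v \<bullet> v = 1"
    using vu(1) by (simp add: norm_eq_1)
  then have at_w': "v \<bullet> (w' - x\<^sub>0) = \<zeta>" "u \<bullet> (w' - x\<^sub>0) = 0"
    using vu(3) by (simp_all add: w'_def inner_commute)
  have "P \<ge> 0" "(\<Sum>i=1..n. q i) \<ge> 0"
    using P p q by (auto intro: sum_nonneg)
  have diff: "P / n / 2 * (v \<bullet> (w - x\<^sub>0) - \<zeta>)\<^sup>2 \<le> F w - F w'" for w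
    unfolding F_def finite_sum_bowl[OF n P \<zeta>(1)] at_w'
    using \<open>(\<Sum>i=1..n. q i) \<ge> 0\<close> by simp
  moreover have "0 \<le> P / n / 2 * (v \<bullet> (w - x\<^sub>0) - \<zeta>)\<^sup>2" for w
    using \<open>P \<ge> 0\<close> by simp
  ultimately have min: "F w' \<le> F w" for w
    by (smt (verit))
  then have "(INF w. F w) = F w'"
    by (intro cInf_eq_minimum) auto
  with diff show "P / n / 2 * (v \<bullet> (w - x\<^sub>0) - \<zeta>)\<^sup>2 \<le> F w - (INF w. F w)"
    by simp
  have "dist x\<^sub>0 w' \<le> R"
    using vu(1) \<zeta>(2) by (simp add: w'_def dist_norm)
  with min show "(\<lambda>i. bowl x\<^sub>0 v u (p i) (q i) (z i)) \<in> problems n L R x\<^sub>0"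
    using vu p q by (auto simp: problems_def F_def intro!: convex_on_bowl smooth_fun_bowl)
qed

section \<open>At least a constant fraction of the components must be accessed\<close>

text \<open>
  The component \<open>i\<^sub>0\<close> is centred at \<open>\<eta> * s * n * R\<close>, all others at \<open>0\<close>, so the average is centred at
  \<open>\<eta> * s * R\<close>. With \<open>2 * k \<le> n\<close> iterations, some \<open>i\<^sub>0\<close> is not accessed with probability at least
  \<open>1/2\<close>. The problems of interest have \<open>\<eta> = 1\<close>. The parameter serves to connect the two signs at
  \<open>\<eta> = 0\<close>: without an access to \<open>i\<^sub>0\<close> the runs are constant in \<open>\<eta>\<close>, hence equal.
\<close>

lemma iterations_ge_components:
  fixes a :: "('w, 'd::finite) cli"
  assumes a: "oblivious_cli n a" and n: "n > 0" and R: "R > 0" and L: "L > 0" and \<epsilon>: "\<epsilon> > 0" "\<epsilon> < L * R\<^sup>2 / 8"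
    and solved: "\<And>f W. f \<in> problems n L R (init a 1) \<Longrightarrow> cli_run f a W \<Longrightarrow>
      eps_solution \<epsilon> (space_of a) (finite_sum n f) (W k 1)"
  shows "n < 2 * k"
proof (rule ccontr)
  assume "\<not> n < 2 * k"
  moreover have "card {i \<in> {1..n}. m \<in> {i}} \<le> 1" for m
    using card_mono[of "{m}" "{i \<in> {1..n}. m \<in> {i}}"] by auto
  ultimately obtain i\<^sub>0 where i\<^sub>0: "i\<^sub>0 \<in> {1..n}" and
    rare: "measure (space_of a) {\<omega> \<in> space (space_of a). hits {i\<^sub>0} a k \<omega> \<le> 0} \<ge> 1 / 2"
    using rarely_accessed_set[OF a n, of "\<lambda>i. {i}" 1 k 0] by force
  define v where "v = (axis undefined 1 :: real^'d)"
  define z where "z s \<eta> i = (if i = i\<^sub>0 then \<eta> * s * (n * R) else 0)" for s \<eta> and i :: nat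
  define f where "f = (\<lambda>s \<eta> i. bowl (init a 1) v 0 L 0 (z s \<eta> i))"
  define t where "t s \<eta> i j w = - (v \<bullet> (w - init a 1) - z s \<eta> i) / v $ j" for s \<eta> i j w
  have v: "norm v = 1"
    by (simp add: v_def)
  have poly_residual: "poly_curve (m + of_bool (i \<in> {i\<^sub>0})) (\<lambda>\<eta>. v \<bullet> (y \<eta> - init a 1) - z s \<eta> i)"
    if "poly_curve m y" for m y s i
  proof (intro poly_curve_diff poly_curve_inner)
    show "poly_curve (m + of_bool (i \<in> {i\<^sub>0})) y"
      using that by (rule poly_curve_mono) simp
    have "poly_curve (Suc 0) (\<lambda>\<eta>. \<eta> *\<^sub>R (s * (n * R)))"
      by (rule poly_curve_id_times[OF poly_curve_const])
    then show "poly_curve (m + of_bool (i \<in> {i\<^sub>0})) (\<lambda>\<eta>. z s \<eta> i)"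
      by (auto simp: z_def mult.assoc intro: poly_curve_mono poly_curve_const)
  qed (rule poly_curve_const)
  have t_eq: "t s \<eta> i j w = (- inverse (v $ j)) *\<^sub>R (v \<bullet> (w - init a 1) - z s \<eta> i)" for s \<eta> i j w
    by (simp add: t_def divide_inverse algebra_simps)
  interpret polynomial_family f
    "\<lambda>s \<eta> i. bowl_gradient (init a 1) v 0 L 0 (z s \<eta> i)" t "{i\<^sub>0}" "{1}"
    unfolding f_def
  proof (rule polynomial_family_bowl)
    show "continuous_on UNIV (t s \<eta> i j)" for s \<eta> i j
      unfolding t_eq by (intro continuous_intros)
    show "poly_curve (m + of_bool (i \<in> {i\<^sub>0})) (\<lambda>\<eta>. L * (v \<bullet> (y \<eta> - init a 1) - z s \<eta> i))"
      if "poly_curve m y" for m y s i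
      using poly_curve_scaleR[OF poly_residual[OF that], where c = L] by simp
    show "poly_curve (m + of_bool (i \<in> {i\<^sub>0})) (\<lambda>\<eta>. t s \<eta> i j (y \<eta>))"
      if "poly_curve m y" for m y s i j
      unfolding t_eq using that by (intro poly_curve_scaleR poly_residual)
    show "poly_curve (m + of_bool (i \<in> {i\<^sub>0})) (\<lambda>\<eta>. 0 * (0 \<bullet> (y \<eta> - init a 1)))"
      for m i and y :: "real \<Rightarrow> real^'d"
      by (simp add: poly_curve_const)
  qed (use L in \<open>auto simp: t_def z_def\<close>)
  have problem: "f s 1 \<in> problems n L R (init a 1)"
    and growth: "L / 2 * (v \<bullet> (w - init a 1) - s * R)\<^sup>2
      \<le> finite_sum n (f s 1) w - (INF w. finite_sum n (f s 1) w)" if "s \<in> {1, -1}" for s w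
  proof -
    have "(\<Sum>i=1..n. L) = n * L" "(\<Sum>i=1..n. L * z s 1 i) = n * L * (s * R)" "\<bar>s * R\<bar> \<le> R"
      using i\<^sub>0 that R by (auto simp: z_def sum_distrib_left[symmetric])
    note bowls_in_problems[OF n v _ _ _ _ _ _ this, where L = L and u = 0 and q = "\<lambda>_. 0" and x\<^sub>0 = "init a 1"]
    then show "f s 1 \<in> problems n L R (init a 1)"
      "L / 2 * (v \<bullet> (w - init a 1) - s * R)\<^sup>2 \<le> finite_sum n (f s 1) w - (INF w. finite_sum n (f s 1) w)"
      using n L by (simp_all add: f_def)
  qed
  have "R \<le> 2 * (\<Sum>j\<in>{()}. \<bar>1\<bar> * sqrt (2 * \<epsilon> / L))"
  proof (rule separation_bound[OF a \<epsilon>(1), where J = "{()}" and c = "\<lambda>_. 1" and x = "\<lambda>_. 1" and T = 0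
        and k = k and \<mu> = "\<lambda>_. L" and v = v and x\<^sub>0 = "init a 1" and \<rho> = R])
    show "1 / 2 \<le> measure (space_of a) {\<omega> \<in> space (space_of a). hits {i\<^sub>0} a k \<omega> \<le> 0}"
      by (fact rare)
    show "poly q 0 = (\<Sum>j\<in>{()}. 1 * poly q 1)" if "degree q \<le> 0" for q :: "real poly"
    proof -
      from that have "degree q = 0" by simp
      then obtain b where "q = [:b:]" by (rule degree_eq_zeroE)
      then show ?thesis by simp
    qed
    fix \<eta> s :: real and W w assume \<eta>: "\<eta> \<in> {1}" and s: "s \<in> {1, -1}"
    show "eps_solution \<epsilon> (space_of a) (finite_sum n (f s \<eta>)) (W k 1)" if "cli_run (f s \<eta>) a W"
      using \<eta> problem[OF s] that by (intro solved) auto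
    show "L / 2 * (v \<bullet> (w - init a 1) - s * R)\<^sup>2 \<le> finite_sum n (f s \<eta>) w - (INF w. finite_sum n (f s \<eta>) w)"
      using \<eta> growth[OF s] by simp
  qed (use L R in simp_all)
  then have "R\<^sup>2 \<le> (2 * sqrt (2 * \<epsilon> / L))\<^sup>2"
    using R by (intro power_mono) auto
  also have "\<dots> = 8 * \<epsilon> / L"
    using \<epsilon> L by (simp add: power_mult_distrib)
  finally show False
    using \<epsilon>(2) L by (simp add: field_simps)
qed

section \<open>Flat problems with a distant minimizer\<close>

text \<open>
  The growth of the average along \<open>v\<close> may be arbitrarily weak, while its minimizers for the two signs
  stay separated by \<open>R\<close> along \<open>v\<close>.
\<close>

definition hard_family ::
  "nat \<Rightarrow> real \<Rightarrow> real \<Rightarrow> real^'d::finite \<Rightarrow> nat set \<Rightarrow> (real \<Rightarrow> real \<Rightarrow> nat \<Rightarrow> real^'d \<Rightarrow> real) \<Rightarrow> bool"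
where
  "hard_family n L R x\<^sub>0 S f \<longleftrightarrow> (\<exists>g t v. polynomial_family f g t S {0<..L} \<and>
    (\<forall>\<eta>\<in>{0<..L}. \<forall>s\<in>{1, -1}. f s \<eta> \<in> problems n L R x\<^sub>0 \<and>
      (\<forall>w. \<eta> / n / 2 * (v \<bullet> (w - x\<^sub>0) - s * (R / 2))\<^sup>2
        \<le> finite_sum n (f s \<eta>) w - (INF w. finite_sum n (f s \<eta>) w))))"

text \<open>
  The component \<open>i\<^sub>0\<close> is the quadratic form with eigenvalue \<open>\<eta>\<close> along \<open>v\<close> and \<open>L - \<eta>\<close> along \<open>u\<close>, where \<open>v\<close>
  and \<open>u\<close> are the diagonals of a coordinate plane, and all other components vanish. The
  diagonal entries in the plane are \<open>L / 2\<close>, independent of \<open>\<eta>\<close>, so a step to a line minimizer divides a component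
  of the gradient by a constant and remains affine in \<open>\<eta>\<close>.
\<close>

lemma hard_family_plane:
  fixes x\<^sub>0 :: "real^'d::finite"
  assumes d: "CARD('d) \<ge> 2" and R: "R > 0" and i\<^sub>0: "i\<^sub>0 \<in> {1..n}"
  shows "\<exists>f. hard_family n L R x\<^sub>0 {i\<^sub>0} f"
proof -
  obtain j\<^sub>1 j\<^sub>2 :: 'd where j: "j\<^sub>1 \<noteq> j\<^sub>2"
    using d by (metis One_nat_def UNIV_I card_2_iff' card_le_Suc0_iff_eq finite numeral_2_eq_2 not_less_eq_eq)
  define v u where "v = (1 / sqrt 2) *\<^sub>R (axis j\<^sub>1 1 - axis j\<^sub>2 1 :: real^'d)"
    and "u = (1 / sqrt 2) *\<^sub>R (axis j\<^sub>1 1 + axis j\<^sub>2 1 :: real^'d)"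
  have "v \<bullet> v = 1" "u \<bullet> u = 1" and vu: "v \<bullet> u = 0"
    using j by (simp_all add: v_def u_def inner_diff_left inner_diff_right inner_add_left inner_add_right inner_axis_axis)
  then have norms: "norm v = 1" "norm u \<le> 1"
    by (simp_all add: norm_eq_1 norm_le_square)
  \<comment> \<open>This makes the second derivative \<open>\<eta> * (v $ j)\<^sup>2 + (L - \<eta>) * (u $ j)\<^sup>2\<close> along a coordinate constant.\<close>
  have coords: "(u $ j)\<^sup>2 = (v $ j)\<^sup>2" for j
    using j by (simp add: v_def u_def axis_def power_mult_distrib)
  define p where "p = (\<lambda>(s::real) \<eta> i. if i = i\<^sub>0 then \<eta> else (0::real))"
  define q where "q = (\<lambda>(s::real) \<eta> i. if i = i\<^sub>0 then L - \<eta> else 0)"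
  define z where "z = (\<lambda>(s::real) (\<eta>::real) (i::nat). s * (R / 2))"
  \<comment> \<open>Division by zero gives the step \<open>0\<close> along coordinates outside the plane, where the function is
    constant.\<close>
  define t where "t = (\<lambda>s \<eta> i j w. - (bowl_gradient x\<^sub>0 v u (p s \<eta> i) (q s \<eta> i) (z s \<eta> i) w $ j) / (L * (v $ j)\<^sup>2))"
  let ?f = "\<lambda>s \<eta> i. bowl x\<^sub>0 v u (p s \<eta> i) (q s \<eta> i) (z s \<eta> i)"
  have t_eq: "t s \<eta> i j w = - inverse (L * (v $ j)\<^sup>2) *\<^sub>R
    (axis j 1 \<bullet> bowl_gradient x\<^sub>0 v u (p s \<eta> i) (q s \<eta> i) (z s \<eta> i) w)" for s \<eta> i j w
    by (simp add: t_def inner_axis' divide_inverse)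
  have poly_v: "poly_curve (m + of_bool (i \<in> {i\<^sub>0})) (\<lambda>\<eta>. p s \<eta> i * (v \<bullet> (y \<eta> - x\<^sub>0) - z s \<eta> i))"
    if "poly_curve m y" for m y s i
  proof -
    have "poly_curve m (\<lambda>\<eta>. v \<bullet> (y \<eta> - x\<^sub>0) - z s \<eta> i)"
      using that unfolding z_def by (intro poly_curve_diff poly_curve_inner poly_curve_const)
    from poly_curve_id_times[OF this] show ?thesis
      by (simp add: p_def z_def poly_curve_const)
  qed
  have poly_u: "poly_curve (m + of_bool (i \<in> {i\<^sub>0})) (\<lambda>\<eta>. q s \<eta> i * (u \<bullet> (y \<eta> - x\<^sub>0)))"
    if "poly_curve m y" for m y s i
  proof -
    have y: "poly_curve m (\<lambda>\<eta>. u \<bullet> (y \<eta> - x\<^sub>0))"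
      using that by (intro poly_curve_diff poly_curve_inner poly_curve_const)
    have "poly_curve (Suc m) (\<lambda>\<eta>. L *\<^sub>R (u \<bullet> (y \<eta> - x\<^sub>0)) - \<eta> *\<^sub>R (u \<bullet> (y \<eta> - x\<^sub>0)))"
      by (intro poly_curve_diff[OF poly_curve_scaleR poly_curve_id_times] y poly_curve_mono[OF y]) simp
    then show ?thesis
      by (simp add: q_def poly_curve_const left_diff_distrib)
  qed
  have fam: "polynomial_family ?f (\<lambda>s \<eta> i. bowl_gradient x\<^sub>0 v u (p s \<eta> i) (q s \<eta> i) (z s \<eta> i)) t {i\<^sub>0} {0<..L}"
  proof (rule polynomial_family_bowl[OF _ _ _ _ poly_v poly_u])
    fix s \<eta> :: real and i j and w :: "real^'d" assume \<eta>: "\<eta> \<in> {0<..L}"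
    define G where "G = bowl_gradient x\<^sub>0 v u (p s \<eta> i) (q s \<eta> i) (z s \<eta> i) w $ j"
    have "p s \<eta> i * (v \<bullet> (w - x\<^sub>0) - z s \<eta> i + t s \<eta> i j w * v $ j) * v $ j
        + q s \<eta> i * (u \<bullet> (w - x\<^sub>0) + t s \<eta> i j w * u $ j) * u $ j
      = G + t s \<eta> i j w * (p s \<eta> i * (v $ j)\<^sup>2 + q s \<eta> i * (u $ j)\<^sup>2)"
      unfolding G_def bowl_gradient_def vector_add_component vector_scaleR_component
      by (simp only: power2_eq_square) (simp add: algebra_simps)
    also have "p s \<eta> i * (v $ j)\<^sup>2 + q s \<eta> i * (u $ j)\<^sup>2 = (if i = i\<^sub>0 then L * (v $ j)\<^sup>2 else 0)"
      unfolding coords by (simp add: p_def q_def algebra_simps)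
    also have "G + t s \<eta> i j w * \<dots> = 0"
    proof (cases "i = i\<^sub>0 \<and> v $ j \<noteq> 0")
      case True
      then show ?thesis
        using \<eta> by (simp add: t_def G_def)
    next
      case False
      moreover have "u $ j = 0" if "v $ j = 0"
        using coords[of j] that by simp
      ultimately have "G = 0"
        by (auto simp: G_def bowl_gradient_def p_def q_def)
      with False show ?thesis
        by auto
    qed
    finally show "p s \<eta> i * (v \<bullet> (w - x\<^sub>0) - z s \<eta> i + t s \<eta> i j w * v $ j) * v $ j
        + q s \<eta> i * (u \<bullet> (w - x\<^sub>0) + t s \<eta> i j w * u $ j) * u $ j = 0" .
  next
    show "continuous_on UNIV (t s \<eta> i j)" for s \<eta> i j
      unfolding t_eq by (intro continuous_intros continuous_bowl_gradient)
    show "poly_curve (m + of_bool (i \<in> {i\<^sub>0})) (\<lambda>\<eta>. t s \<eta> i j (y \<eta>))" if "poly_curve m y" for m y s i j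
      unfolding t_eq bowl_gradient_def
      using that by (intro poly_curve_scaleR poly_curve_inner poly_curve_add poly_curve_times_vector poly_v poly_u)
  qed (auto simp: p_def q_def z_def t_def bowl_gradient_def)
  have hard: "\<forall>\<eta>\<in>{0<..L}. \<forall>s\<in>{1, -1}. ?f s \<eta> \<in> problems n L R x\<^sub>0 \<and>
      (\<forall>w. \<eta> / n / 2 * (v \<bullet> (w - x\<^sub>0) - s * (R / 2))\<^sup>2
        \<le> finite_sum n (?f s \<eta>) w - (INF w. finite_sum n (?f s \<eta>) w))"
  proof (intro ballI)
    fix \<eta> s assume \<eta>: "\<eta> \<in> {0<..L}" and s: "s \<in> {1, -1 :: real}"
    have P: "(\<Sum>i=1..n. p s \<eta> i) = \<eta>"
      using i\<^sub>0 by (simp add: p_def)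
    have \<zeta>: "(\<Sum>i=1..n. p s \<eta> i * z s \<eta> i) = \<eta> * (s * (R / 2))"
      by (simp only: z_def sum_distrib_right[symmetric] P)
    have "\<bar>s * (R / 2)\<bar> \<le> R"
      using s R by auto
    note inst = bowls_in_problems[OF _ norms vu _ _ _ _ P \<zeta> this, where L = L and q = "q s \<eta>" and x\<^sub>0 = x\<^sub>0]
    have "n > 0" and pq: "0 \<le> p s \<eta> i" "p s \<eta> i \<le> L" "0 \<le> q s \<eta> i" "q s \<eta> i \<le> L" for i
      using \<eta> i\<^sub>0 by (auto simp: p_def q_def)
    then show "?f s \<eta> \<in> problems n L R x\<^sub>0 \<and>
      (\<forall>w. \<eta> / n / 2 * (v \<bullet> (w - x\<^sub>0) - s * (R / 2))\<^sup>2
        \<le> finite_sum n (?f s \<eta>) w - (INF w. finite_sum n (?f s \<eta>) w))"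
      by (intro conjI allI inst)
  qed
  show ?thesis
    unfolding hard_family_def by (intro exI) (rule conjI[OF fam hard])
qed

text \<open>
  On a line, exact minimization of a single component reveals its minimizer. The minimizers \<open>R\<close> and
  \<open>- R\<close> of the two components are therefore independent of the sign, which enters through the
  curvatures: they are \<open>\<eta>\<close> and \<open>\<eta> / 3\<close> in one order or the other, so the sum is minimal at
  \<open>s * R / 2\<close>.
\<close>

lemma hard_family_pair:
  fixes x\<^sub>0 :: "real^'d::finite"
  assumes R: "R > 0" and i: "i\<^sub>1 \<in> {1..n}" "i\<^sub>2 \<in> {1..n}" "i\<^sub>1 \<noteq> i\<^sub>2"
  shows "\<exists>f. hard_family n L R x\<^sub>0 {i\<^sub>1, i\<^sub>2} f"
proof -
  \<comment> \<open>Any coordinate direction serves the purpose.\<close>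
  define v where "v = (axis undefined 1 :: real^'d)"
  have v: "norm v = 1"
    by (simp add: v_def)
  define b where "b = (\<lambda>s i. if i = i\<^sub>1 then (2 + s) / 3 else if i = i\<^sub>2 then (2 - s) / 3 else (0::real))"
  define p where "p = (\<lambda>s \<eta> i. \<eta> * b s i)"
  define z where "z = (\<lambda>(s::real) (\<eta>::real) i. if i = i\<^sub>1 then R else if i = i\<^sub>2 then - R else 0)"
  \<comment> \<open>The step goes to the centre of the component for every \<open>\<eta>\<close>, also for \<open>\<eta> = 0\<close>. It is \<open>0\<close> along
    the coordinates orthogonal to \<open>v\<close>.\<close>
  define t where "t = (\<lambda>s \<eta> i j w. - (v \<bullet> (w - x\<^sub>0) - z s \<eta> i) / v $ j)"
  let ?f = "\<lambda>s \<eta> i. bowl x\<^sub>0 v 0 (p s \<eta> i) 0 (z s \<eta> i)"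
  have t_eq: "t s \<eta> i j w = (- inverse (v $ j)) *\<^sub>R (v \<bullet> (w - x\<^sub>0) - z s \<eta> i)" for s \<eta> i j w
    by (simp add: t_def divide_inverse algebra_simps)
  have b: "0 \<le> b s i" "b s i \<le> 1" if "s \<in> {1, -1}" for s i
    using that by (auto simp: b_def)
  have poly_residual: "poly_curve m (\<lambda>\<eta>. v \<bullet> (y \<eta> - x\<^sub>0) - z s \<eta> i)" if "poly_curve m y" for m y s i
    using that unfolding z_def by (intro poly_curve_diff poly_curve_inner poly_curve_const)
  have fam: "polynomial_family ?f (\<lambda>s \<eta> i. bowl_gradient x\<^sub>0 v 0 (p s \<eta> i) 0 (z s \<eta> i)) t {i\<^sub>1, i\<^sub>2} {0<..L}"
  proof (rule polynomial_family_bowl)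
    show "continuous_on UNIV (t s \<eta> i j)" for s \<eta> i j
      unfolding t_eq by (intro continuous_intros)
    show "poly_curve (m + of_bool (i \<in> {i\<^sub>1, i\<^sub>2})) (\<lambda>\<eta>. p s \<eta> i * (v \<bullet> (y \<eta> - x\<^sub>0) - z s \<eta> i))"
      if y: "poly_curve m y" for m y s i
    proof (cases "i \<in> {i\<^sub>1, i\<^sub>2}")
      case True
      with poly_curve_id_times[OF poly_curve_scaleR[OF poly_residual[OF y]], where c1 = "b s i"] show ?thesis
        by (simp add: p_def mult.assoc)
    qed (simp add: p_def b_def poly_curve_const)
    show "poly_curve (m + of_bool (i \<in> {i\<^sub>1, i\<^sub>2})) (\<lambda>\<eta>. t s \<eta> i j (y \<eta>))"
      if y: "poly_curve m y" for m y s i j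
      unfolding t_eq by (intro poly_curve_scaleR poly_curve_mono[OF poly_residual[OF y]]) simp
    show "poly_curve (m + of_bool (i \<in> {i\<^sub>1, i\<^sub>2})) (\<lambda>\<eta>. 0 * (0 \<bullet> (y \<eta> - x\<^sub>0)))"
      for m i and y :: "real \<Rightarrow> real^'d"
      by (simp add: poly_curve_const)
  qed (use b in \<open>auto simp: t_def p_def z_def\<close>)
  have hard: "\<forall>\<eta>\<in>{0<..L}. \<forall>s\<in>{1, -1}. ?f s \<eta> \<in> problems n L R x\<^sub>0 \<and>
      (\<forall>w. \<eta> / n / 2 * (v \<bullet> (w - x\<^sub>0) - s * (R / 2))\<^sup>2
        \<le> finite_sum n (?f s \<eta>) w - (INF w. finite_sum n (?f s \<eta>) w))"
  proof (intro ballI)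
    fix \<eta> s assume \<eta>: "\<eta> \<in> {0<..L}" and s: "s \<in> {1, -1 :: real}"
    have pair: "(\<Sum>i=1..n. h i) = h i\<^sub>1 + h i\<^sub>2" if "\<And>i. i \<notin> {i\<^sub>1, i\<^sub>2} \<Longrightarrow> h i = 0" for h :: "nat \<Rightarrow> real"
      using sum.mono_neutral_right[of "{1..n}" "{i\<^sub>1, i\<^sub>2}" h] i that by auto
    have "(\<Sum>i=1..n. p s \<eta> i) = 4 / 3 * \<eta>"
      using i(3) by (subst pair) (auto simp: p_def b_def field_simps)
    moreover have "(\<Sum>i=1..n. p s \<eta> i * z s \<eta> i) = 4 / 3 * \<eta> * (s * (R / 2))"
      using i(3) by (subst pair) (auto simp: p_def b_def z_def field_simps)
    moreover have "\<bar>s * (R / 2)\<bar> \<le> R"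
      using s R by auto
    moreover have p: "0 \<le> p s \<eta> i" "p s \<eta> i \<le> L" for i
      using b[OF s, of i] \<eta> mult_mono[of \<eta> L "b s i" 1] by (auto simp: p_def)
    moreover have "n > 0" "0 \<le> L"
      using i \<eta> by auto
    ultimately have prob: "?f s \<eta> \<in> problems n L R x\<^sub>0"
      and growth: "4 / 3 * \<eta> / n / 2 * (v \<bullet> (w - x\<^sub>0) - s * (R / 2))\<^sup>2
        \<le> finite_sum n (?f s \<eta>) w - (INF w. finite_sum n (?f s \<eta>) w)" for w
      using bowls_in_problems[OF _ v, where L = L and R = R and u = 0 and p = "p s \<eta>" and q = "\<lambda>_. 0" and n = n
          and z = "z s \<eta>" and P = "4 / 3 * \<eta>" and \<zeta> = "s * (R / 2)" and x\<^sub>0 = x\<^sub>0]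
      by simp_all
    have "\<eta> / n / 2 * (v \<bullet> (w - x\<^sub>0) - s * (R / 2))\<^sup>2 \<le> 4 / 3 * \<eta> / n / 2 * (v \<bullet> (w - x\<^sub>0) - s * (R / 2))\<^sup>2" for w
      using \<eta> by (intro mult_right_mono divide_right_mono) auto
    from order_trans[OF this growth] prob show "?f s \<eta> \<in> problems n L R x\<^sub>0 \<and>
      (\<forall>w. \<eta> / n / 2 * (v \<bullet> (w - x\<^sub>0) - s * (R / 2))\<^sup>2
        \<le> finite_sum n (?f s \<eta>) w - (INF w. finite_sum n (?f s \<eta>) w))"
      by (intro conjI allI)
  qed
  show ?thesis
    unfolding hard_family_def by (intro exI) (rule conjI[OF fam hard])
qed

lemma hard_families_exist:
  fixes x\<^sub>0 :: "real^'d::finite"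
  assumes n: "n \<ge> 1" and nd: "n \<ge> 2 \<or> CARD('d) \<ge> 2" and R: "R > 0"
  obtains S where "\<And>i. i \<in> {1..n} \<Longrightarrow> \<exists>f. hard_family n L R x\<^sub>0 (S i) f"
    and "\<And>m. m \<in> {1..n} \<Longrightarrow> card {i \<in> {1..n}. m \<in> S i} \<le> 2"
proof (cases "n \<ge> 2")
  case True
  \<comment> \<open>In the cyclic pairs of neighbours, each component occurs for exactly two indices \<open>i\<close>, also if
    \<open>n = 2\<close>, where both pairs are the same.\<close>
  define next_ix where "next_ix i = (if i = n then 1 else i + 1)" for i
  show thesis
  proof (rule that[of "\<lambda>i. {i, next_ix i}"])
    show "\<exists>f. hard_family n L R x\<^sub>0 {i, next_ix i} f" if "i \<in> {1..n}" for i
      using that True by (intro hard_family_pair R) (auto simp: next_ix_def)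
    fix m
    have "card {i \<in> {1..n}. m \<in> {i, next_ix i}} \<le> card {m, if m = 1 then n else m - 1}"
      by (intro card_mono) (auto simp: next_ix_def split: if_splits)
    also have "\<dots> \<le> 2"
      by (simp add: card_insert_if)
    finally show "card {i \<in> {1..n}. m \<in> {i, next_ix i}} \<le> 2" .
  qed
next
  case False
  show thesis
  proof (rule that[of "\<lambda>i. {i}"])
    show "\<exists>f. hard_family n L R x\<^sub>0 {i} f" if "i \<in> {1..n}" for i
      using that False nd by (intro hard_family_plane R) auto
    show "card {i \<in> {1..n}. m \<in> {i}} \<le> 2" for m
      by (rule order_trans[OF card_mono[of "{m}"]]) auto
  qed
qed

section \<open>The bound on the number of iterations\<close>

text \<open>
  The term \<open>n\<close> on the right is due to the rounding in \<open>T = \<lfloor>4 * k / n\<rfloor>\<close>, and to the fact that even a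
  constant can approximate both minimizers well enough if the problem is flat. It is absorbed by
  \<open>iterations_ge_components\<close>.
\<close>

lemma iterations_ge_sqrt:
  fixes a :: "('w, 'd::finite) cli"
  assumes a: "oblivious_cli n a" and n: "n > 0" and R: "R > 0" and L: "L > 0" and \<epsilon>: "\<epsilon> > 0"
    and solved: "\<And>f W. f \<in> problems n L R (init a 1) \<Longrightarrow> cli_run f a W \<Longrightarrow>
      eps_solution \<epsilon> (space_of a) (finite_sum n f) (W k 1)"
    and hard: "\<And>i. i \<in> {1..n} \<Longrightarrow> \<exists>f. hard_family n L R (init a 1) (S i) f"
    and cover: "\<And>m. m \<in> {1..n} \<Longrightarrow> card {i \<in> {1..n}. m \<in> S i} \<le> 2"
  shows "R * sqrt (n * L / \<epsilon>) \<le> 24 * (8 * real k + n)"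
proof -
  define T where "T = 4 * k div n"
  have "2 * 2 * k \<le> (T + 1) * n"
    using n dividend_less_div_times[of n "4 * k"] by (simp add: T_def algebra_simps)
  then obtain i where i: "i \<in> {1..n}" and
    rare: "measure (space_of a) {\<omega> \<in> space (space_of a). hits (S i) a k \<omega> \<le> T} \<ge> 1 / 2"
    using rarely_accessed_set[OF a n, of S 2 k T] cover by blast
  from hard[OF i] obtain f g t v where fam: "polynomial_family f g t (S i) {0<..L}"
    and family: "\<forall>\<eta>\<in>{0<..L}. \<forall>s\<in>{1, -1}. f s \<eta> \<in> problems n L R (init a 1) \<and>
      (\<forall>w. \<eta> / n / 2 * (v \<bullet> (w - init a 1) - s * (R / 2))\<^sup>2
        \<le> finite_sum n (f s \<eta>) w - (INF w. finite_sum n (f s \<eta>) w))"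
    unfolding hard_family_def by (elim exE conjE)
  have prob: "f s \<eta> \<in> problems n L R (init a 1)"
    if "\<eta> \<in> {0<..L}" "s \<in> {1, -1}" for s \<eta>
    by (rule conjunct1[OF bspec[OF bspec[OF family that(1)] that(2)]])
  have growth: "\<eta> / n / 2 * (v \<bullet> (w - init a 1) - s * (R / 2))\<^sup>2
      \<le> finite_sum n (f s \<eta>) w - (INF w. finite_sum n (f s \<eta>) w)"
    if "\<eta> \<in> {0<..L}" "s \<in> {1, -1}" for s \<eta> w
    by (rule spec[OF conjunct2[OF bspec[OF bspec[OF family that(1)] that(2)]]])
  interpret polynomial_family f g t "S i" "{0<..L}"
    by (fact fam)
  obtain x c :: "nat \<Rightarrow> real" where x: "\<And>j. j \<le> T \<Longrightarrow> 0 < x j \<and> x j \<le> L"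
    and c: "\<And>q :: real poly. degree q \<le> T \<Longrightarrow> poly q 0 = (\<Sum>j\<le>T. c j * poly q (x j))"
    and weights: "(\<Sum>j\<le>T. \<bar>c j\<bar> / sqrt (x j)) \<le> 4 * (2 * real T + 1) / sqrt L"
    by (rule interpolation_at_zero[OF L, where T = T]) (rule that)
  have "R / 2 \<le> 2 * (\<Sum>j\<le>T. \<bar>c j\<bar> * sqrt (2 * \<epsilon> / (x j / n)))"
  proof (rule separation_bound[OF a \<epsilon>, where J = "{..T}" and c = c and x = x and T = T and k = k
        and \<mu> = "\<lambda>\<eta>. \<eta> / n" and v = v and x\<^sub>0 = "init a 1" and \<rho> = "R / 2"])
    show "eps_solution \<epsilon> (space_of a) (finite_sum n (f s \<eta>)) (W k 1)"
      if "\<eta> \<in> {0<..L}" "s \<in> {1, -1}" "cli_run (f s \<eta>) a W" for s \<eta> W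
      using prob[OF that(1,2)] that(3) by (rule solved)
    show "\<eta> / n / 2 * (v \<bullet> (w - init a 1) - s * (R / 2))\<^sup>2
        \<le> finite_sum n (f s \<eta>) w - (INF w. finite_sum n (f s \<eta>) w)"
      if "\<eta> \<in> {0<..L}" "s \<in> {1, -1}" for s \<eta> w
      using that by (rule growth)
    show "1 / 2 \<le> measure (space_of a) {\<omega> \<in> space (space_of a). hits (S i) a k \<omega> \<le> T}"
      by (fact rare)
    show "poly q 0 = (\<Sum>j\<le>T. c j * poly q (x j))" if "degree q \<le> T" for q :: "real poly"
      using that by (rule c)
  qed (use x R n in auto)
  also have "(\<Sum>j\<le>T. \<bar>c j\<bar> * sqrt (2 * \<epsilon> / (x j / n))) = sqrt (2 * \<epsilon> * n) * (\<Sum>j\<le>T. \<bar>c j\<bar> / sqrt (x j))"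
    by (simp add: sum_distrib_left real_sqrt_divide mult_ac)
  also have "\<dots> \<le> sqrt (2 * \<epsilon> * n) * (4 * (2 * real T + 1) / sqrt L)"
    using \<epsilon> by (intro mult_left_mono weights) auto
  finally have "R * sqrt L \<le> 16 * sqrt 2 * (2 * real T + 1) * sqrt (\<epsilon> * n)"
    using L by (simp add: field_simps real_sqrt_mult)
  also have "\<dots> \<le> 24 * (2 * real T + 1) * sqrt (\<epsilon> * n)"
  proof -
    have "sqrt 2 \<le> 3 / 2"
      by (rule real_le_lsqrt) (simp_all add: power2_eq_square)
    then show ?thesis
      using \<epsilon> by (intro mult_right_mono) auto
  qed
  finally have *: "R * sqrt L \<le> 24 * (2 * real T + 1) * sqrt (\<epsilon> * n)" .
  have "real T * n \<le> 4 * real k"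
    unfolding T_def by (metis (mono_tags) div_times_less_eq_dividend of_nat_le_iff of_nat_mult of_nat_numeral)
  have "R * sqrt (n * L / \<epsilon>) = R * sqrt L * (sqrt n / sqrt \<epsilon>)"
    by (simp add: real_sqrt_mult real_sqrt_divide)
  also have "\<dots> \<le> 24 * (2 * real T + 1) * sqrt (\<epsilon> * n) * (sqrt n / sqrt \<epsilon>)"
    using \<epsilon> by (intro mult_right_mono *) auto
  also have "\<dots> = 24 * (2 * real T + 1) * (sqrt (\<epsilon> * n) * (sqrt n / sqrt \<epsilon>))"
    by (simp only: mult.assoc)
  also have "sqrt (\<epsilon> * n) * (sqrt n / sqrt \<epsilon>) = n"
    using \<epsilon> by (simp add: real_sqrt_mult)
  also have "24 * (2 * real T + 1) * n = 24 * (2 * (real T * n) + n)"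
    by (simp add: algebra_simps)
  also have "\<dots> \<le> 24 * (8 * real k + n)"
    using \<open>real T * n \<le> 4 * real k\<close> by simp
  finally show ?thesis .
qed

(* The case of a single function on the line is excluded: one exact coordinate minimization
   solves such a problem. *)
theorem theorem4:
  fixes alg :: "nat \<Rightarrow> real \<Rightarrow> ('w, 'd::finite) cli"
    and R \<alpha> \<gamma> :: real and N :: "nat \<Rightarrow> nat" and n\<^sub>0 :: nat
  assumes "R > 0" and "\<alpha> > 0" and "\<gamma> > 0"
    and "n\<^sub>0 \<ge> 1" and "n\<^sub>0 \<ge> 2 \<or> CARD('d) \<ge> 2"
    and "\<And>n L. n \<ge> n\<^sub>0 \<Longrightarrow> L > 0 \<Longrightarrow> oblivious_cli n (alg n L)"
    and "is_big_O n\<^sub>0 (\<lambda>n L \<epsilon>. iteration_complexity n L R \<epsilon> (alg n L))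
           (\<lambda>n L \<epsilon>. real (N n) + real n powr \<gamma> * (L / \<epsilon>) powr \<alpha>)"
  shows "is_big_Omega n\<^sub>0 (\<lambda>n L \<epsilon>. iteration_complexity n L R \<epsilon> (alg n L))
           (\<lambda>n L \<epsilon>. real n + sqrt (real n * L / \<epsilon>))"
proof -
  \<comment> \<open>The two lower bounds give \<open>n < 2 * k\<close> and \<open>R * sqrt (n * L / \<epsilon>) \<le> 24 * (8 * k + n) \<le> 240 * k\<close>.
    The constant \<open>\<kappa>\<close> ensures \<open>\<epsilon> \<le> L * R\<^sup>2 / 16\<close>.\<close>
  define c where "c = 1 / (2 + 240 / R)"
  define \<kappa> where "\<kappa> = 16 / R\<^sup>2"
  have "c > 0" "\<kappa> > 0"
    using \<open>R > 0\<close> by (simp_all add: c_def \<kappa>_def add_pos_pos)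
  moreover have "ereal (c * (real n + sqrt (real n * L / \<epsilon>)))
      \<le> ereal_of_enat (iteration_complexity n L R \<epsilon> (alg n L))"
    if n: "n \<ge> n\<^sub>0" and L: "L > 0" and \<epsilon>: "\<epsilon> > 0" and \<kappa>: "L / \<epsilon> \<ge> \<kappa>" for n L \<epsilon>
  proof -
    let ?a = "alg n L"
    define K where "K = {k. \<forall>f \<in> problems n L R (init ?a 1). \<forall>W. cli_run f ?a W \<longrightarrow>
      eps_solution \<epsilon> (space_of ?a) (finite_sum n f) (W k 1)}"
    have a: "oblivious_cli n ?a"
      using assms(6) n L .
    have n1: "n \<ge> 1" "n > 0" "n \<ge> 2 \<or> CARD('d) \<ge> 2"
      using n assms(4,5) by auto
    have "\<epsilon> * (2 * 8) \<le> L * R\<^sup>2"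
      using \<kappa> \<epsilon> \<open>R > 0\<close> by (simp add: \<kappa>_def field_simps)
    then have small: "\<epsilon> < L * R\<^sup>2 / 8"
      using \<epsilon> by simp
    have bound: "c * (real n + sqrt (real n * L / \<epsilon>)) \<le> real k" if "k \<in> K" for k
    proof -
      have solved: "eps_solution \<epsilon> (space_of ?a) (finite_sum n f) (W k 1)"
        if "f \<in> problems n L R (init ?a 1)" "cli_run f ?a W" for f W
        using \<open>k \<in> K\<close> that by (auto simp: K_def)
      have "n < 2 * k"
        by (rule iterations_ge_components[OF a n1(2) \<open>R > 0\<close> L \<epsilon> small]) (rule solved)
      moreover have "R * sqrt (n * L / \<epsilon>) \<le> 24 * (8 * real k + n)"
      proof -
        obtain S where "\<And>i. i \<in> {1..n} \<Longrightarrow> \<exists>f. hard_family n L R (init ?a 1) (S i) f"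
          "\<And>m. m \<in> {1..n} \<Longrightarrow> card {i \<in> {1..n}. m \<in> S i} \<le> 2"
          by (rule hard_families_exist[OF n1(1,3) \<open>R > 0\<close>, of L "init ?a 1"]) (rule that)
        then show ?thesis
          by (intro iterations_ge_sqrt[OF a n1(2) \<open>R > 0\<close> L \<epsilon>, where S = S] solved)
      qed
      ultimately have "real n \<le> 2 * real k" "R * sqrt (n * L / \<epsilon>) \<le> 240 * real k"
        by (simp, simp)
      moreover from this(2) have "sqrt (n * L / \<epsilon>) \<le> 240 / R * real k"
        using \<open>R > 0\<close> by (simp add: field_simps)
      ultimately have "real n + sqrt (n * L / \<epsilon>) \<le> (2 + 240 / R) * real k"
        by (simp add: distrib_right)
      then show ?thesis
        using \<open>R > 0\<close> by (simp add: c_def field_simps add_pos_pos)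
    qed
    have complexity: "iteration_complexity n L R \<epsilon> ?a = Inf (enat ` K)"
      by (simp add: iteration_complexity_def K_def)
    show ?thesis
    proof (cases "K = {}")
      case True
      then show ?thesis
        by (simp add: complexity Inf_enat_def)
    next
      case False
      then obtain k where "enat k \<in> enat ` K" by auto
      then have "Inf (enat ` K) \<in> enat ` K"
        by (rule wellorder_InfI)
      then obtain k where "k \<in> K" "Inf (enat ` K) = enat k" by auto
      with bound[of k] show ?thesis
        by (simp add: complexity)
    qed
  qed
  ultimately show ?thesis
    unfolding is_big_Omega_def by blast
qed

end
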